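(* Let $S$ be the unit square centred at the origin and let $f$ be a probability density on $S$ for which there are constants $0<\epsilon_1\le\epsilon_2<\infty$ with $\epsilon_1\le\inf_{x\in S}f(x)\le\sup_{x\in S}f(x)\le\epsilon_2$. For each $n\ge1$ let $X_1,\dots,X_n$ be independent random points in $S$, each with density $f$, and let $TSP_n$ be the length of the minimum length spanning cycle containing all of $X_1,\dots,X_n$. Then there is a constant $C>0$ such that $$ \mathbb{E}\left(TSP_n-\mathbb{E}\,TSP_n\right)^2\le C n^{2/3}\quad\text{for all } n\ge 1, $$ and so in particular $$ \frac{1}{\sqrt n}\left(TSP_n-\mathbb{E}\,TSP_n\right)\longrightarrow 0\ \text{ in probability as } n\to\infty. $$ Also there are positive constants $\theta_1,\theta_2,\theta_3$ such that for all $n$ large $$ \theta_1\sqrt n\le \mathbb{E}\,TSP_n\le 5\sqrt n, $$ $$ \mathbb{P}\left(TSP_n\le 5\sqrt n\right)=1 $$ and $$ \mathbb{P}\left(TSP_n\ge\theta_2\sqrt n\right)\ge 1-\exp\left(-\frac{\theta_3 n}{\log n}\right). $$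
   Context: A spanning cycle on a finite set of at least 3 points in the plane is a cycle visiting each point exactly once (a Hamiltonian cycle of the complete graph on the points); its length is the sum of the Euclidean lengths of its edges, including the closing edge. $TSP_n$ is the minimum of this length over all spanning cycles on $\{X_1,\dots,X_n\}$; by convention $TSP_n=0$ for $n\le 2$. *)

theory Defs
  imports "HOL-Probability.Probability"
begin

definition unit_square :: "(real \<times> real) set" where
  "unit_square = {-1/2..1/2} \<times> {-1/2..1/2}"

definition prob_density_on :: "'a::euclidean_space set \<Rightarrow> ('a \<Rightarrow> real) \<Rightarrow> bool" where
  "prob_density_on S f \<longleftrightarrow>
     set_borel_measurable lborel S f \<and> (\<forall>x\<in>S. 0 \<le> f x) \<and>
     (\<integral>\<^sup>+ x\<in>S. ennreal (f x) \<partial>lborel) = 1"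

text \<open>A cycle is listed as its successive vertices from some starting point; the closing edge
  runs from the last entry back to the first.  The requirement of at least three points
  makes the cyclic sequence a genuine cycle of the complete graph.\<close>

definition spanning_cycle :: "'a set \<Rightarrow> 'a list \<Rightarrow> bool" where
  "spanning_cycle A p \<longleftrightarrow> 3 \<le> card A \<and> distinct p \<and> set p = A"

definition cycle_length :: "'a::metric_space list \<Rightarrow> real" where
  "cycle_length p = (\<Sum>i<length p. dist (p ! i) (p ! ((i + 1) mod length p)))"

definition tsp_length :: "'a::metric_space set \<Rightarrow> real" where
  "tsp_length A =
     (if card A \<le> 2 then 0 else Min {cycle_length p |p. spanning_cycle A p})"

text \<open>The set of points visited is formed pointwise, so coinciding points count once; for points
  with a common density this only concerns a null set.\<close>

definition TSP :: "(nat \<Rightarrow> nat \<Rightarrow> 'w \<Rightarrow> 'a::metric_space) \<Rightarrow> nat \<Rightarrow> 'w \<Rightarrow> real" where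
  "TSP X n \<omega> = tsp_length ((\<lambda>i. X n i \<omega>) ` {1..n})"

definition converges_in_prob :: "'w measure \<Rightarrow> (nat \<Rightarrow> 'w \<Rightarrow> real) \<Rightarrow> real \<Rightarrow> bool" where
  "converges_in_prob M Y c \<longleftrightarrow>
     (\<forall>\<epsilon>>0. (\<lambda>n. measure M {\<omega> \<in> space M. \<bar>Y n \<omega> - c\<bar> > \<epsilon>}) \<longlonglongrightarrow> 0)"

end

theory Submission
  imports Defs
begin

text \<open>Inserting a point into a tour next to a given vertex costs at most twice their distance, and
  deleting a point costs nothing.  Placing each vertex of a shortest tour next to its successor,
  the squared changes of the tour length under deletion of a vertex add up to at most
  a constant times the tour length itself, which is \<open>O(\<surd>n)\<close> by the strip construction.  The Efron--Stein
  inequality then bounds the variance by \<open>O(\<surd>n)\<close>, which is better than \<open>O(n\<^bsup>2/3\<^esup>)\<close>.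

  For the lower tail, cut the square into about \<open>n\<close> cells.  A cycle of length \<open>\<theta> \<surd>n\<close> meets only
  \<open>\<beta> n\<close> of them, and by a union bound over the at most \<open>2\<^bsup>4n\<^esup>\<close> sets of cells the points
  crowd into so few cells with probability at most \<open>(16 \<epsilon>\<^sub>2 \<beta>)\<^bsup>n\<^esup>\<close>, which is
  \<open>exp (- n)\<close> for \<open>\<beta> = 1 / (16 e \<epsilon>\<^sub>2)\<close>.\<close>

section \<open>Tours of indexed families\<close>

fun path_length :: "'a::metric_space list \<Rightarrow> real" where
  "path_length (a # b # p) = dist a b + path_length (b # p)"
| "path_length _ = 0"

lemma path_length_conv_sum:
  "path_length p = (\<Sum>i<length p - 1. dist (p ! i) (p ! Suc i))"
  by (induction p rule: path_length.induct) (auto simp: sum.lessThan_Suc_shift simp del: sum.lessThan_Suc)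

lemma path_length_nonneg: "0 \<le> path_length p"
  by (induction p rule: path_length.induct) auto

lemma path_length_append: "path_length (p @ a # q) = path_length (p @ [a]) + path_length (a # q)"
  by (induction p rule: path_length.induct) auto

lemma cycle_length_Nil [simp]: "cycle_length [] = 0"
  by (simp add: cycle_length_def)

text \<open>Repeating the first vertex at the end replaces indices modulo the length by a recursion
  along the list.\<close>

lemma cycle_length_Cons: "cycle_length (a # p) = path_length (a # p @ [a])"
proof -
  have "(a # p @ [a]) ! i = (a # p) ! i"
    and "(a # p @ [a]) ! Suc i = (a # p) ! (Suc i mod Suc (length p))"
    if "i < Suc (length p)" for i
    using that by (auto simp: nth_append nth_Cons' mod_Suc)
  then show ?thesis
    by (simp add: cycle_length_def path_length_conv_sum del: path_length.simps nth_Cons_Suc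
        cong: sum.cong_simp)
qed

lemma cycle_length_nonneg: "0 \<le> cycle_length p"
  by (simp add: cycle_length_def sum_nonneg)

text \<open>Cut at the first vertices \<open>a\<close> of \<open>p\<close> and \<open>b\<close> of
  \<open>q\<close>, both closed paths fall into the same two segments, one from \<open>a\<close> to
  \<open>b\<close> and one from \<open>b\<close> back to \<open>a\<close>.\<close>

lemma cycle_length_rotate: "cycle_length (p @ q) = cycle_length (q @ p)"
proof (cases p; cases q)
  fix a p' b q' assume "p = a # p'" "q = b # q'"
  then show ?thesis
    using path_length_append[of "a # p'" b "q' @ [a]"] path_length_append[of "b # q'" a "p' @ [b]"]
    by (simp add: cycle_length_Cons)
qed auto

lemma path_length_snoc_triangle:
  "path_length (p @ [a]) \<le> path_length (p @ [b]) + dist b a"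
proof (induction p rule: path_length.induct)
  case ("2_2" v)
  then show ?case by (simp add: dist_triangle)
qed auto

text \<open>With \<open>a\<close> rotated to the front, its two edges are replaced by the one
  joining its neighbours, and a single triangle inequality remains.\<close>

lemma cycle_length_remove: "cycle_length (p @ q) \<le> cycle_length (p @ a # q)"
proof -
  have "cycle_length (q @ p) \<le> cycle_length (a # q @ p)"
  proof (cases "q @ p")
    case (Cons b r)
    have "path_length ((b # r) @ [b]) \<le> path_length ((b # r) @ [a]) + dist a b"
      by (rule path_length_snoc_triangle)
    with Cons show ?thesis by (simp add: cycle_length_Cons)
  qed (simp add: cycle_length_nonneg)
  then show ?thesis
    using cycle_length_rotate[of p q] cycle_length_rotate[of p "a # q"] by simp
qed

text \<open>The edge entering \<open>b\<close> is rerouted to \<open>a\<close>, which lengthens it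
  by at most \<open>dist a b\<close>; the edge from \<open>a\<close> on to \<open>b\<close> costs
  \<open>dist a b\<close> once more.\<close>

lemma cycle_length_insert: "cycle_length (p @ a # b # q) \<le> cycle_length (p @ b # q) + 2 * dist a b"
proof -
  have "path_length ((b # q @ p) @ [a]) \<le> path_length ((b # q @ p) @ [b]) + dist b a"
    by (rule path_length_snoc_triangle)
  then have "cycle_length (a # b # q @ p) \<le> cycle_length (b # q @ p) + 2 * dist a b"
    by (simp add: cycle_length_Cons dist_commute)
  then show ?thesis
    using cycle_length_rotate[of p "b # q"] cycle_length_rotate[of p "a # b # q"] by simp
qed

section \<open>Shortest tours of a finite index set\<close>

definition orderings :: "'i set \<Rightarrow> 'i list set" where
  "orderings I = {l. distinct l \<and> set l = I}"

lemma finite_orderings: "finite I \<Longrightarrow> finite (orderings I)"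
  unfolding orderings_def by (rule finite_subset[OF _ finite_subset_distinct[of I]]) auto

lemma orderings_nonempty: "finite I \<Longrightarrow> orderings I \<noteq> {}"
  unfolding orderings_def using finite_distinct_list by blast

lemma length_orderings: "l \<in> orderings I \<Longrightarrow> length l = card I"
  by (auto simp: orderings_def distinct_card)

text \<open>Coinciding points count separately, which changes no length and saves treating ties.\<close>

definition tour :: "('i \<Rightarrow> 'a::metric_space) \<Rightarrow> 'i set \<Rightarrow> real" where
  "tour x I = Min ((\<lambda>l. cycle_length (map x l)) ` orderings I)"

lemma tour_le: "finite I \<Longrightarrow> l \<in> orderings I \<Longrightarrow> tour x I \<le> cycle_length (map x l)"
  by (simp add: tour_def finite_orderings)

lemma tour_attained:
  assumes "finite I"
  obtains l where "l \<in> orderings I" "tour x I = cycle_length (map x l)"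
proof -
  have "tour x I \<in> (\<lambda>l. cycle_length (map x l)) ` orderings I"
    unfolding tour_def using assms by (intro Min_in) (auto simp: finite_orderings orderings_nonempty)
  then show ?thesis using that by blast
qed

lemma tour_nonneg: "finite I \<Longrightarrow> 0 \<le> tour x I"
  by (metis tour_attained cycle_length_nonneg)

lemma tour_eq_0:
  assumes "finite I" "card I \<le> 1"
  shows "tour x I = 0"
proof -
  obtain l where "l \<in> orderings I" "tour x I = cycle_length (map x l)"
    using tour_attained[OF assms(1)] .
  moreover from this have "length l \<le> 1"
    using assms(2) length_orderings by metis
  ultimately show ?thesis
    by (cases l) (auto simp: cycle_length_Cons)
qed

lemma tour_cong: "(\<And>i. i \<in> I \<Longrightarrow> x i = y i) \<Longrightarrow> tour x I = tour y I"
  unfolding tour_def by (intro arg_cong[of _ _ Min] image_cong refl arg_cong[of _ _ cycle_length])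
    (auto simp: orderings_def)

lemma tour_remove:
  assumes "finite I"
  shows "tour x (I - {i}) \<le> tour x I"
proof (cases "i \<in> I")
  case True
  obtain l where l: "l \<in> orderings I" "tour x I = cycle_length (map x l)"
    using tour_attained[OF assms] .
  then obtain p q where pq: "l = p @ i # q"
    using True by (auto simp: orderings_def in_set_conv_decomp)
  then have "p @ q \<in> orderings (I - {i})"
    using l by (auto simp: orderings_def)
  then have "tour x (I - {i}) \<le> cycle_length (map x (p @ q))"
    using assms by (intro tour_le) auto
  also have "\<dots> \<le> tour x I"
    using l pq cycle_length_remove by auto
  finally show ?thesis .
qed auto

lemma tour_insert:
  assumes "finite I" "i \<in> I" "j \<in> I" "i \<noteq> j"
  shows "tour x I \<le> tour x (I - {i}) + 2 * dist (x i) (x j)"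
proof -
  obtain l where l: "l \<in> orderings (I - {i})" "tour x (I - {i}) = cycle_length (map x l)"
    using tour_attained[of "I - {i}"] assms by blast
  then obtain p q where pq: "l = p @ j # q"
    using assms split_list[of j l] by (auto simp: orderings_def)
  then have "p @ i # j # q \<in> orderings I"
    using l assms by (auto simp: orderings_def)
  then have "tour x I \<le> cycle_length (map x (p @ i # j # q))"
    using assms by (intro tour_le) auto
  also have "\<dots> \<le> tour x (I - {i}) + 2 * dist (x i) (x j)"
    using l pq cycle_length_insert by auto
  finally show ?thesis .
qed

text \<open>A deleted vertex can be put back in front of its old successor, so its deletion saves at
  most twice the edge between them. In the square one such edge is bounded by \<open>D\<close>; the
  other ones add up to the shortest tour. A bound linear in the tour length is what makes the
  variance of order \<open>sqrt n\<close>.\<close>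

lemma sum_tour_remove_le:
  assumes "finite I" and diam: "\<And>i j. i \<in> I \<Longrightarrow> j \<in> I \<Longrightarrow> dist (x i) (x j) \<le> D"
  shows "(\<Sum>i\<in>I. (tour x I - tour x (I - {i}))\<^sup>2) \<le> 4 * D * tour x I"
proof (cases "card I \<le> 1")
  case True
  moreover have "card (I - {i}) \<le> card I" for i
    using assms(1) by (intro card_mono) auto
  ultimately show ?thesis
    using assms(1) by (simp add: tour_eq_0 order_trans[of "card (I - {_})" "card I" 1])
next
  case False
  obtain l where l: "l \<in> orderings I" "tour x I = cycle_length (map x l)"
    using tour_attained[OF assms(1)] .
  let ?n = "length l"
  have n: "?n = card I" "?n \<ge> 2" "distinct l" "set l = I"
    using l False length_orderings[OF l(1)] by (auto simp: orderings_def)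
  let ?nx = "\<lambda>k. (k + 1) mod ?n"
  have "(\<Sum>i\<in>I. (tour x I - tour x (I - {i}))\<^sup>2) = (\<Sum>k<?n. (tour x I - tour x (I - {l ! k}))\<^sup>2)"
    using n by (intro sum.reindex_bij_betw[symmetric] bij_betw_nth) auto
  also have "\<dots> \<le> (\<Sum>k<?n. 4 * D * dist (x (l ! k)) (x (l ! ?nx k)))"
  proof (rule sum_mono)
    fix k assume "k \<in> {..<?n}"
    \<comment> \<open>From two vertices on, the cyclic successor is a different vertex; hence the
      separate case of at most one vertex.\<close>
    then have k: "k < ?n" "?nx k < ?n" "?nx k \<noteq> k"
      using n by (auto simp: mod_Suc)
    then have ne: "l ! k \<noteq> l ! ?nx k" "l ! k \<in> I" "l ! ?nx k \<in> I"
      using n by (auto simp: nth_eq_iff_index_eq)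
    let ?d = "dist (x (l ! k)) (x (l ! ?nx k))"
    have "\<bar>tour x I - tour x (I - {l ! k})\<bar> \<le> 2 * ?d"
      using tour_insert[OF assms(1) ne(2,3,1), of x] tour_remove[OF assms(1), of x "l ! k"] by linarith
    then have "(tour x I - tour x (I - {l ! k}))\<^sup>2 \<le> (2 * ?d)\<^sup>2"
      by (subst abs_le_square_iff[symmetric]) simp
    also have "\<dots> = 4 * ?d * ?d"
      by (simp add: power2_eq_square)
    also have "\<dots> \<le> 4 * D * ?d"
      using diam[OF ne(2,3)] by (intro mult_right_mono) auto
    finally show "(tour x I - tour x (I - {l ! k}))\<^sup>2 \<le> 4 * D * ?d" .
  qed
  also have "\<dots> = 4 * D * tour x I"
    unfolding l(2) cycle_length_def sum_distrib_left using n by (intro sum.cong) auto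
  finally show ?thesis .
qed

text \<open>Indices are added one at a time, each next to one with the same point: insertion then
  costs twice the distance 0, and removal costs nothing.\<close>

lemma tour_superset_duplicates:
  assumes "finite I" "J \<subseteq> I" "x ` J = x ` I"
  shows "tour x I = tour x J"
proof -
  have "K \<subseteq> I - J \<Longrightarrow> tour x (J \<union> K) = tour x J" if "finite K" for K
    using that
  proof (induction K rule: finite_induct)
    case (insert k K)
    then obtain j where j: "j \<in> J" "x j = x k" using assms by (metis DiffD1 imageE image_eqI insert_subset)
    have "tour x (J \<union> insert k K) = tour x (J \<union> insert k K - {k})"
      using insert j assms tour_insert[of "J \<union> insert k K" k j x] tour_remove[of "J \<union> insert k K" x k]
      by (auto intro: finite_subset antisym)
    also have "J \<union> insert k K - {k} = J \<union> K"
      using insert by auto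
    finally show ?case using insert by auto
  qed auto
  from this[of "I - J"] show ?thesis
    using assms by (simp add: Un_absorb1)
qed

text \<open>For injective \<open>x\<close>, mapping \<open>x\<close> over lists turns the orderings
  of the indices into exactly the orderings of the points.\<close>

lemma tour_inj_image:
  assumes "inj_on x I" "finite I"
  shows "tour x I = tour id (x ` I)"
proof -
  have "map x ` orderings I = orderings (x ` I)"
  proof (intro equalityI subsetI)
    fix p assume p: "p \<in> orderings (x ` I)"
    then have "map (inv_into I x) p \<in> orderings I"
      using assms by (auto simp: orderings_def distinct_map inj_on_inv_into image_image
          intro: inv_into_into)
    moreover have "map x (map (inv_into I x) p) = p"
      using p by (auto simp: orderings_def f_inv_into_f intro!: map_idI)
    ultimately show "p \<in> map x ` orderings I"
      by (metis imageI)
  qed (use assms in \<open>auto simp: orderings_def distinct_map\<close>)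
  then show ?thesis
    unfolding tour_def by (simp add: image_image flip: \<open>map x ` orderings I = _\<close>)
qed

text \<open>One index per distinct point carries the whole tour: the other indices are free
  duplicates, and on the chosen ones \<open>x\<close> is injective.\<close>

lemma tour_eq_image:
  assumes "finite I"
  shows "tour x I = tour id (x ` I)"
proof -
  obtain J where "J \<subseteq> I" "x ` I = x ` J" "inj_on x J"
    using subset_image_inj[of "x ` I" x I] by auto
  then show ?thesis
    using tour_superset_duplicates[of I J x] tour_inj_image[of x J] assms
    by (auto dest: finite_subset)
qed

text \<open>From three points on, spanning cycles are the orderings of the point set. Only for two
  points can the lengths differ: there \<open>tour\<close> runs along the segment and back, while
  \<open>tsp_length\<close> is 0 by convention.\<close>

lemma tsp_length_eq_tour:
  assumes "finite I"
  shows "tsp_length (x ` I) = (if card (x ` I) \<le> 2 then 0 else tour x I)"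
  unfolding tsp_length_def tour_eq_image[OF assms, of x]
  by (auto simp: tour_def orderings_def spanning_cycle_def intro!: arg_cong[of _ _ Min])

lemma tsp_length_le_tour: "finite I \<Longrightarrow> tsp_length (x ` I) \<le> tour x I"
  and tsp_length_nonneg: "finite I \<Longrightarrow> 0 \<le> tsp_length (x ` I)"
  by (auto simp: tsp_length_eq_tour tour_nonneg)

text \<open>A difference arises only when at most two distinct points occur, and then the tour has
  at most two edges.\<close>

lemma tour_le_tsp_length:
  assumes "finite I" and diam: "\<And>i j. i \<in> I \<Longrightarrow> j \<in> I \<Longrightarrow> dist (x i) (x j) \<le> D" and "0 \<le> D"
  shows "tour x I \<le> tsp_length (x ` I) + 2 * D"
proof (cases "card (x ` I) \<le> 2")
  case True
  obtain l where l: "l \<in> orderings (x ` I)"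
    using orderings_nonempty[of "x ` I"] assms by auto
  have len: "length l \<le> 2"
    using True l length_orderings by fastforce
  have "tour x I \<le> cycle_length (map id l)"
    unfolding tour_eq_image[OF assms(1), of x] using l assms by (intro tour_le) auto
  also have "\<dots> \<le> (\<Sum>i<length l. D)"
    unfolding cycle_length_def length_map
  proof (rule sum_mono)
    fix i assume "i \<in> {..<length l}"
    then have "i < length l" "(i + 1) mod length l < length l"
      by (auto intro!: mod_less_divisor)
    then have "l ! i \<in> x ` I" "l ! ((i + 1) mod length l) \<in> x ` I"
      using l nth_mem[of i l] nth_mem[of "(i + 1) mod length l" l] by (auto simp: orderings_def)
    then show "dist (map id l ! i) (map id l ! ((i + 1) mod length l)) \<le> D"
      using diam by auto
  qed
  also have "\<dots> \<le> 2 * D"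
    using len \<open>0 \<le> D\<close> by (simp add: mult_right_mono)
  finally show ?thesis
    using tsp_length_nonneg[OF assms(1), of x] by linarith
qed (use assms in \<open>auto simp: tsp_length_eq_tour\<close>)

section \<open>The strip bound\<close>

lemma path_length_snoc:
  "path_length (b # p @ [a]) = path_length (b # p) + dist (last (b # p)) a"
  by (induction p arbitrary: b) auto

text \<open>The increments of \<open>\<Phi>\<close> telescope along the sorted list, while
  \<open>d\<close> is paid once per edge.\<close>

lemma path_length_sorted_le:
  assumes "sorted (map \<Phi> (a # p))"
    and "\<And>p q. p \<in> S \<Longrightarrow> q \<in> S \<Longrightarrow> \<Phi> p \<le> \<Phi> q \<Longrightarrow> dist p q \<le> c * (\<Phi> q - \<Phi> p) + d"
    and "set (a # p) \<subseteq> S"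
  shows "path_length (a # p) \<le> c * (\<Phi> (last (a # p)) - \<Phi> a) + d * length p"
  using assms(1,3)
proof (induction p arbitrary: a)
  case (Cons b p)
  have "path_length (b # p) \<le> c * (\<Phi> (last (b # p)) - \<Phi> b) + d * length p"
    using Cons by (intro Cons.IH) auto
  moreover have "dist a b \<le> c * (\<Phi> b - \<Phi> a) + d"
    using Cons.prems by (intro assms(2)) auto
  ultimately show ?case by (simp add: algebra_simps)
qed simp

text \<open>The points are visited in the order of \<open>\<Phi>\<close>. The total climb is at most
  \<open>R\<close>, and the closing edge costs at most \<open>D\<close>.\<close>

lemma tour_le_potential:
  fixes \<Phi> :: "'a::metric_space \<Rightarrow> real"
  assumes "finite I" "x ` I \<subseteq> S"
    and pot: "\<And>p q. p \<in> S \<Longrightarrow> q \<in> S \<Longrightarrow> \<Phi> p \<le> \<Phi> q \<Longrightarrow> dist p q \<le> c * (\<Phi> q - \<Phi> p) + d"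
    and range: "\<And>p q. p \<in> S \<Longrightarrow> q \<in> S \<Longrightarrow> \<Phi> q - \<Phi> p \<le> R"
    and diam: "\<And>p q. p \<in> S \<Longrightarrow> q \<in> S \<Longrightarrow> dist p q \<le> D"
    and "0 \<le> c" "0 \<le> d" "0 \<le> R" "0 \<le> D"
  shows "tour x I \<le> c * R + d * card I + D"
proof -
  obtain l0 where "set l0 = I" "distinct l0"
    using finite_distinct_list[OF assms(1)] by blast
  define l where "l = sort_key (\<Phi> \<circ> x) l0"
  have l: "l \<in> orderings I" "sorted (map \<Phi> (map x l))"
    using \<open>set l0 = I\<close> \<open>distinct l0\<close> sorted_sort_key[of "\<Phi> \<circ> x" l0]
    by (auto simp: l_def orderings_def comp_def)
  have "cycle_length (map x l) \<le> c * R + d * length l + D"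
  proof (cases "map x l")
    case (Cons a p)
    have S: "set (a # p) \<subseteq> S"
      using l(1) assms(2) unfolding Cons[symmetric] by (auto simp: orderings_def)
    then have last: "last (a # p) \<in> S" "a \<in> S"
      using last_in_set[of "a # p"] by auto
    have "path_length (a # p) \<le> c * (\<Phi> (last (a # p)) - \<Phi> a) + d * length p"
      using l(2) S pot unfolding Cons by (intro path_length_sorted_le) auto
    also have "\<dots> \<le> c * R + d * length l"
      using range[OF last(2,1)] arg_cong[OF Cons, of length] assms
      by (intro add_mono mult_left_mono) auto
    finally show ?thesis
      using diam[OF last] by (simp add: Cons cycle_length_Cons path_length_snoc)
  qed (use assms in auto)
  then show ?thesis
    using tour_le[OF assms(1) l(1), of x] length_orderings[OF l(1)] by simp
qed

lemma dist_prod_le: "dist p q \<le> dist (fst p) (fst q) + dist (snd p) (snd q)"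
  unfolding dist_prod_def by (rule sqrt_sum_squares_le_sum) auto

lemma dist_unit_square_le: "p \<in> unit_square \<Longrightarrow> q \<in> unit_square \<Longrightarrow> dist p q \<le> 2"
  using dist_prod_le[of p q] by (auto simp: unit_square_def dist_real_def)

text \<open>Going through horizontal strips of height \<open>1 / k\<close> one after another, each from left to right:
  the potential orders the points that way, and twice the strip index pays for the
  jumps back to the left.\<close>

lemma tour_le_strips:
  assumes "finite I" "x ` I \<subseteq> unit_square" "0 < (k::nat)"
  shows "tour x I \<le> 2 * k + card I / k + 6"
proof -
  define s where "s p = \<lfloor>k * (snd p + 1/2)\<rfloor>" for p :: "real \<times> real"
  define \<Phi> where "\<Phi> p = fst p + 2 * of_int (s p)" for p
  \<comment> \<open>The index \<open>k\<close> is attained on the upper edge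
    \<open>snd p = 1/2\<close>, which forms a strip of its own; this gives the range
    \<open>2 * k + 1\<close> of \<open>\<Phi>\<close>.\<close>
  have s: "0 \<le> s p" "s p \<le> k" if "p \<in> unit_square" for p
  proof -
    have "real k * (snd p + 1/2) \<le> real k * 1"
      using that by (intro mult_left_mono) (auto simp: unit_square_def)
    then show "s p \<le> k" unfolding s_def by linarith
    show "0 \<le> s p" using that by (auto simp: unit_square_def s_def)
  qed
  have "tour x I \<le> (1 + 1 / k) * (2 * k + 1) + 1 / k * card I + 2"
  proof (rule tour_le_potential[of I x unit_square \<Phi>])
    fix p q assume pq: "p \<in> unit_square" "q \<in> unit_square"
    then have x: "\<bar>fst p - fst q\<bar> \<le> 1"
      by (auto simp: unit_square_def)
    show "\<Phi> q - \<Phi> p \<le> 2 * k + 1"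
      using s[OF pq(1)] s[OF pq(2)] x unfolding \<Phi>_def by linarith
    assume le: "\<Phi> p \<le> \<Phi> q"
    then have ss: "s p \<le> s q"
      using x unfolding \<Phi>_def by linarith
    \<comment> \<open>Within a strip \<open>\<Phi>\<close> grows with the first coordinate. A rise
      by \<open>j > 0\<close> strips raises \<open>\<Phi>\<close> by at least
      \<open>2 * j - 1\<close>, which is at least \<open>j\<close> and so also at least the width 1
      of the square.\<close>
    have dx: "\<bar>fst p - fst q\<bar> \<le> \<Phi> q - \<Phi> p" and ds: "s q - s p \<le> \<Phi> q - \<Phi> p"
      using x le ss unfolding \<Phi>_def by (cases "s p = s q"; linarith)+
    have "k * \<bar>snd p - snd q\<bar> = \<bar>k * (snd p + 1/2) - k * (snd q + 1/2)\<bar>"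
      by (simp add: abs_mult flip: right_diff_distrib)
    also have "\<dots> \<le> (s q - s p) + 1"
      using ss unfolding s_def by linarith
    finally have "k * \<bar>snd p - snd q\<bar> \<le> (\<Phi> q - \<Phi> p) + 1"
      using ds by linarith
    then have "\<bar>snd p - snd q\<bar> \<le> (\<Phi> q - \<Phi> p + 1) / k"
      using assms(3) by (simp add: field_simps)
    then show "dist p q \<le> (1 + 1 / k) * (\<Phi> q - \<Phi> p) + 1 / k"
      using dist_prod_le[of p q] dx by (simp add: dist_real_def algebra_simps add_divide_distrib diff_divide_distrib)
  qed (use assms dist_unit_square_le in auto)
  also have "(1 + 1 / k) * (2 * k + 1) = 2 * k + 3 + 1 / k"
    using assms(3) by (simp add: field_simps)
  finally have "tour x I \<le> 2 * k + card I / k + 5 + 1 / k"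
    by simp
  moreover have "1 / real k \<le> 1"
    using assms(3) by simp
  ultimately show ?thesis by linarith
qed

lemma tour_le_sqrt:
  assumes "finite I" "x ` I \<subseteq> unit_square"
  shows "tour x I \<le> 3 * sqrt (card I) + 8"
proof (cases "I = {}")
  case False
  \<comment> \<open>This choice balances \<open>2 * k\<close> against \<open>card I / k\<close>;
    rounding up adds at most 2, whence the constant 8.\<close>
  define k where "k = nat \<lceil>sqrt (card I)\<rceil>"
  have pos: "0 < card I"
    using False assms by (simp add: card_gt_0_iff)
  then have k: "0 < k" "sqrt (card I) \<le> k" "k \<le> sqrt (card I) + 1"
    unfolding k_def by (auto simp: of_nat_nat)
  have "card I / k \<le> card I / sqrt (card I)"
    using k pos by (intro divide_left_mono) auto
  also have "\<dots> = sqrt (card I)"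
    by (simp add: real_div_sqrt)
  finally show ?thesis
    using tour_le_strips[OF assms k(1)] k by simp
qed (simp add: tour_eq_0)

section \<open>Occupied cells\<close>

text \<open>Index of the half-open grid square of side \<open>1 / k\<close> that contains the point,
  counted from the lower left corner of the unit square.\<close>

definition cell :: "real \<Rightarrow> real \<times> real \<Rightarrow> int \<times> int" where
  "cell k p = (\<lfloor>k * (fst p + 1/2)\<rfloor>, \<lfloor>k * (snd p + 1/2)\<rfloor>)"

lemma floor_near:
  assumes "\<bar>a - b\<bar> < (1::real)"
  shows "\<lfloor>a\<rfloor> \<in> {\<lfloor>b\<rfloor> - 1..\<lfloor>b\<rfloor> + 1}"
  using assms by simp linarith

text \<open>The path is cut by arc length into pieces of length \<open>1 / k\<close>. Vertices in
  one piece are less than \<open>1 / k\<close> apart, so their cells lie in the 3 by 3 block around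
  the cell of one representative; there are at most \<open>1 + k * path_length p\<close>
  pieces.\<close>

lemma card_cells_le_path_length:
  assumes "0 < k"
  shows "card (cell k ` set p) \<le> 9 * (1 + k * path_length p)"
proof -
  \<comment> \<open>Arc length from the start of the path to its vertex number
    \<open>i\<close>.\<close>
  define t where "t i = (\<Sum>m<i. dist (p ! m) (p ! Suc m))" for i
  have t_dist: "dist (p ! i) (p ! j) \<le> t j - t i" if "i \<le> j" for i j
    using that
  proof (induction j rule: dec_induct)
    case (step j)
    then show ?case
      using dist_triangle[of "p ! i" "p ! Suc j" "p ! j"] by (simp add: t_def)
  qed simp
  have t_abs: "dist (p ! i) (p ! j) \<le> \<bar>t j - t i\<bar>" for i j
    using t_dist[of i j] t_dist[of j i] by (cases "i \<le> j") (auto simp: dist_commute)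
  have t: "0 \<le> t i" "t i \<le> path_length p" if "i < length p" for i
    using that unfolding t_def path_length_conv_sum by (auto intro!: sum_nonneg sum_mono2)
  \<comment> \<open>\<open>g i\<close> is the number of the piece containing vertex
    \<open>i\<close>; \<open>r\<close> below picks a representative vertex of each piece.\<close>
  define g where "g i = nat \<lfloor>k * t i\<rfloor>" for i
  define V where "V = g ` {..<length p}"
  define N where "N c = {fst c - 1..fst c + 1} \<times> {snd c - 1..snd c + 1}" for c :: "int \<times> int"
  define r where "r v = (SOME i. i < length p \<and> g i = v)" for v
  have r: "r v < length p" "g (r v) = v" if "v \<in> V" for v
    using someI_ex[of "\<lambda>i. i < length p \<and> g i = v"] that by (auto simp: V_def r_def)
  have "cell k ` set p \<subseteq> (\<Union>v\<in>V. N (cell k (p ! r v)))"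
  proof
    fix c assume "c \<in> cell k ` set p"
    then obtain i where i: "i < length p" "c = cell k (p ! i)"
      by (auto simp: in_set_conv_nth)
    define j where "j = r (g i)"
    have v: "g i \<in> V" using i by (auto simp: V_def)
    then have j: "j < length p" "g j = g i"
      using r by (auto simp: j_def)
    have "\<bar>k * t j - k * t i\<bar> < 1"
      using j t(1)[OF i(1)] t(1)[OF j(1)] assms unfolding g_def
      by (smt (verit, ccfv_SIG) eq_nat_nat_iff floor_less_iff le_floor_iff mult_nonneg_nonneg
          zero_le_floor of_int_floor_le real_of_int_floor_add_one_gt)
    then have "k * dist (p ! i) (p ! j) < 1"
      using t_abs[of i j] assms by (simp flip: right_diff_distrib add: abs_mult)
        (smt (verit) mult_left_mono)
    moreover have "k * dist (fst (p ! i)) (fst (p ! j)) \<le> k * dist (p ! i) (p ! j)"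
      "k * dist (snd (p ! i)) (snd (p ! j)) \<le> k * dist (p ! i) (p ! j)"
      using assms by (auto intro!: mult_left_mono dist_fst_le dist_snd_le)
    ultimately have "k * dist (fst (p ! i)) (fst (p ! j)) < 1" "k * dist (snd (p ! i)) (snd (p ! j)) < 1"
      by linarith+
    then have
      "\<bar>k * (fst (p ! i) + 1/2) - k * (fst (p ! j) + 1/2)\<bar> < 1"
      "\<bar>k * (snd (p ! i) + 1/2) - k * (snd (p ! j) + 1/2)\<bar> < 1"
      using assms by (simp_all add: dist_real_def abs_mult flip: right_diff_distrib)
    then have "c \<in> N (cell k (p ! j))"
      using floor_near unfolding i N_def cell_def by simp
    then show "c \<in> (\<Union>v\<in>V. N (cell k (p ! r v)))"
      using v j_def by auto
  qed
  then have "card (cell k ` set p) \<le> card (\<Union>v\<in>V. N (cell k (p ! r v)))"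
    by (intro card_mono) (auto simp: V_def N_def)
  also have "\<dots> \<le> (\<Sum>v\<in>V. card (N (cell k (p ! r v))))"
    by (rule card_UN_le) (auto simp: V_def)
  also have "\<dots> = 9 * card V"
    by (simp add: N_def)
  \<comment> \<open>Pieces are numbered from 0, hence the additional one.\<close>
  also have "card V \<le> card {..nat \<lfloor>k * path_length p\<rfloor>}"
    using t assms by (intro card_mono) (auto simp: V_def g_def intro!: nat_mono floor_mono)
  finally have "real (card (cell k ` set p)) \<le> 9 * (real (nat \<lfloor>k * path_length p\<rfloor>) + 1)"
    by simp
  moreover have "real (nat \<lfloor>k * path_length p\<rfloor>) \<le> k * path_length p"
    using assms path_length_nonneg[of p] by (simp add: of_nat_nat)
  ultimately show ?thesis by (simp add: algebra_simps)
qed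

text \<open>A cycle is a path with its first vertex repeated, which occupies no new cell. For at
  most two points the length is 0 and the additive 9 covers their cells.\<close>

lemma card_cells_le_tsp_length:
  assumes "0 < k" "finite I"
  shows "card (cell k ` x ` I) \<le> 9 * (1 + k * tsp_length (x ` I))"
proof (cases "card (x ` I) \<le> 2")
  case True
  have "card (cell k ` x ` I) \<le> card (x ` I)"
    using assms by (intro card_image_le) auto
  then show ?thesis
    using True by (simp add: tsp_length_def)
next
  case False
  obtain l where l: "l \<in> orderings I" "tour x I = cycle_length (map x l)"
    using tour_attained[OF assms(2)] .
  moreover from l False have "l \<noteq> []"
    by (auto simp: orderings_def)
  then obtain a p where ap: "map x l = a # p"
    by (cases "map x l") auto
  ultimately have "tsp_length (x ` I) = path_length (a # p @ [a])"
    using False assms(2) by (simp add: tsp_length_eq_tour cycle_length_Cons)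
  moreover have "x ` I = set (a # p @ [a])"
    using l(1) arg_cong[OF ap, of set] by (auto simp: orderings_def)
  ultimately show ?thesis
    using card_cells_le_path_length[OF assms(1), of "a # p @ [a]"] by simp
qed

section \<open>Range, measurability and area of the cells\<close>

lemma cell_in_range:
  assumes "p \<in> unit_square"
  shows "cell (real k) p \<in> {0..int k} \<times> {0..int k}"
proof -
  \<comment> \<open>Equality holds on the right and upper edges, so each index takes
    \<open>k + 1\<close> values.\<close>
  have "real k * (a + 1/2) \<le> real k * 1" if "a \<le> 1/2" for a :: real
    using that by (intro mult_left_mono) auto
  from this[of "fst p"] this[of "snd p"] show ?thesis
    using assms by (auto simp: unit_square_def cell_def floor_le_iff)
qed

lemma cell_vimage:
  assumes "0 < k"
  shows "cell k -` {c} =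
    {of_int (fst c) / k - 1/2..<(of_int (fst c) + 1) / k - 1/2} \<times>
    {of_int (snd c) / k - 1/2..<(of_int (snd c) + 1) / k - 1/2}"
  using assms by (cases c) (auto simp: cell_def floor_eq_iff field_simps)

lemma measurable_cell [measurable]:
  assumes "0 < k"
  shows "cell k \<in> measurable borel (count_space UNIV)"
proof -
  have "cell k -` {c} \<in> sets borel" for c
    unfolding cell_vimage[OF assms] borel_prod[symmetric] by auto
  then show ?thesis
    by (auto simp: measurable_count_space_eq_countable)
qed

lemma emeasure_cell:
  assumes "0 < k"
  shows "emeasure lborel (cell k -` {c}) = ennreal (1 / k\<^sup>2)"
proof -
  have "emeasure (lborel \<Otimes>\<^sub>M lborel) (cell k -` {c}) = ennreal (1 / k) * ennreal (1 / k)"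
    unfolding cell_vimage[OF assms] using assms
    by (subst lborel.emeasure_pair_measure_Times) (auto simp: divide_right_mono simp flip: diff_divide_distrib)
  then show ?thesis
    using assms by (simp add: lborel_prod power2_eq_square flip: ennreal_mult)
qed

text \<open>If few values occur, then all \<open>Y i\<close> fall into one set \<open>U\<close> of
  at most \<open>m\<close> values inside \<open>G\<close>. A fixed \<open>U\<close> captures each
  \<open>Y i\<close> with probability at most \<open>m * q\<close>, and all of them, by
  independence, with at most the product; a union bound over the sets \<open>U\<close>
  concludes.\<close>

lemma (in prob_space) prob_few_values:
  assumes indep: "indep_vars (\<lambda>_. count_space UNIV) Y I" and "finite I" "I \<noteq> {}" "finite G"
    and G: "\<And>i. i \<in> I \<Longrightarrow> AE \<omega> in M. Y i \<omega> \<in> G"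
    and q: "\<And>i c. i \<in> I \<Longrightarrow> prob {\<omega> \<in> space M. Y i \<omega> = c} \<le> q"
    and "0 \<le> m" and A: "\<And>\<omega>. \<omega> \<in> A \<Longrightarrow> \<omega> \<in> space M \<and> real (card ((\<lambda>i. Y i \<omega>) ` I)) \<le> m"
  shows "prob A \<le> 2 ^ card G * (m * q) ^ card I"
proof -
  have [measurable]: "Y i \<in> measurable M (count_space UNIV)" if "i \<in> I" for i
    using indep that by (auto simp: indep_vars_def)
  define E where "E U = (\<Inter>i\<in>I. Y i -` U \<inter> space M)" for U
  have E_sets [measurable]: "E U \<in> events" for U
    unfolding E_def using assms(2,3) by (intro sets.finite_INT) auto
  let ?\<U> = "{U \<in> Pow G. real (card U) \<le> m}"
  have fin: "finite ?\<U>" using \<open>finite G\<close> by auto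
  obtain i0 where i0: "i0 \<in> I" using assms by auto
  have "q \<ge> 0" using q[OF i0, of undefined] measure_nonneg order_trans by blast
  have "AE \<omega> in M. \<forall>i\<in>I. Y i \<omega> \<in> G"
    using G \<open>finite I\<close> by (simp add: AE_ball_countable countable_finite)
  then have "AE \<omega> in M. \<omega> \<in> A \<longrightarrow> \<omega> \<in> (\<Union>U\<in>?\<U>. E U)"
  proof eventually_elim
    case (elim \<omega>)
    then show ?case
      by (intro impI UN_I[of "(\<lambda>i. Y i \<omega>) ` I"]) (use A in \<open>auto simp: E_def\<close>)
  qed
  then have "prob A \<le> prob (\<Union>U\<in>?\<U>. E U)"
    using fin by (intro finite_measure_mono_AE sets.finite_UN E_sets)
  also have "\<dots> \<le> (\<Sum>U\<in>?\<U>. prob (E U))"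
    using fin by (intro finite_measure_subadditive_finite) auto
  also have "\<dots> \<le> (\<Sum>U\<in>?\<U>. (m * q) ^ card I)"
  proof (rule sum_mono)
    fix U assume U: "U \<in> ?\<U>"
    then have "finite U" using \<open>finite G\<close> finite_subset by auto
    have "prob (E U) = (\<Prod>i\<in>I. prob (Y i -` U \<inter> space M))"
      unfolding E_def using assms by (intro indep_varsD[OF indep]) auto
    also have "\<dots> \<le> (\<Prod>i\<in>I. m * q)"
    proof (intro prod_mono conjI)
      fix i assume i: "i \<in> I"
      have "prob (Y i -` U \<inter> space M) = prob (\<Union>c\<in>U. {\<omega> \<in> space M. Y i \<omega> = c})"
        by (intro arg_cong[of _ _ prob]) auto
      also have "\<dots> \<le> (\<Sum>c\<in>U. prob {\<omega> \<in> space M. Y i \<omega> = c})"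
        using \<open>finite U\<close> i by (intro finite_measure_subadditive_finite) auto
      also have "\<dots> \<le> card U * q"
        using q[OF i] by (intro sum_bounded_above) auto
      also have "\<dots> \<le> m * q"
        using U \<open>q \<ge> 0\<close> by (intro mult_right_mono) auto
      finally show "prob (Y i -` U \<inter> space M) \<le> m * q" .
    qed simp
    finally show "prob (E U) \<le> (m * q) ^ card I" by simp
  qed
  also have "\<dots> \<le> 2 ^ card G * (m * q) ^ card I"
  proof -
    \<comment> \<open>Counting all subsets of \<open>G\<close> instead of the small ones is
      affordable, since \<open>q\<close> will be of order \<open>1 / card I\<close> and
      \<open>m\<close> a small multiple of \<open>card I\<close>.\<close>
    have "card ?\<U> \<le> card (Pow G)"
      using \<open>finite G\<close> by (intro card_mono) auto
    from of_nat_mono[OF this, where 'a = real] have "real (card ?\<U>) \<le> 2 ^ card G"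
      using \<open>finite G\<close> by (simp add: card_Pow)
    then show ?thesis
      using \<open>0 \<le> m\<close> \<open>0 \<le> q\<close> by (simp add: mult_right_mono)
  qed
  finally show ?thesis .
qed

section \<open>The Efron--Stein inequality\<close>

text \<open>The mean squared deviation from \<open>m\<close> is the variance plus the squared bias,
  and the variance is the least mean squared deviation from any constant \<open>c\<close>.\<close>

lemma (in prob_space) square_deviation_le:
  fixes u :: "'a \<Rightarrow> real"
  assumes [measurable]: "u \<in> borel_measurable M" and B: "\<And>x. \<bar>u x\<bar> \<le> B"
  shows "(\<integral>x. (u x - m)\<^sup>2 \<partial>M) \<le> (\<integral>x. (u x - c)\<^sup>2 \<partial>M) + ((\<integral>x. u x \<partial>M) - m)\<^sup>2"
proof -
  have [simp]: "integrable M u"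
    using B by (intro integrable_const_bound[where B = B]) auto
  have "(u x)\<^sup>2 \<le> B\<^sup>2" for x
    using B[of x] by (simp add: abs_le_square_iff[symmetric])
  then have [simp]: "integrable M (\<lambda>x. (u x)\<^sup>2)"
    by (intro integrable_const_bound[where B = "B\<^sup>2"]) auto
  have *: "(\<integral>x. (u x - a)\<^sup>2 \<partial>M) = (\<integral>x. (u x)\<^sup>2 \<partial>M) - 2 * a * (\<integral>x. u x \<partial>M) + a\<^sup>2" for a
    by (simp add: power2_diff prob_space mult.assoc mult.left_commute)
  \<comment> \<open>This square is exactly the difference of the two sides.\<close>
  have "0 \<le> ((\<integral>x. u x \<partial>M) - c)\<^sup>2" by simp
  then show ?thesis
    unfolding * by (simp add: power2_diff algebra_simps)
qed

text \<open>The Jensen inequality for squares, read off from the nonnegativity of the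
  variance.\<close>

lemma (in prob_space) square_integral_le:
  fixes u :: "'a \<Rightarrow> real"
  assumes "u \<in> borel_measurable M" and "\<And>x. \<bar>u x\<bar> \<le> B"
  shows "(\<integral>x. u x \<partial>M)\<^sup>2 \<le> (\<integral>x. (u x)\<^sup>2 \<partial>M)"
proof -
  have [simp]: "integrable M u"
    using assms by (intro integrable_const_bound[where B = B]) auto
  have "(u x)\<^sup>2 \<le> B\<^sup>2" for x
    using assms(2)[of x] by (simp add: abs_le_square_iff[symmetric])
  then have [simp]: "integrable M (\<lambda>x. (u x)\<^sup>2)"
    using assms(1) by (intro integrable_const_bound[where B = "B\<^sup>2"]) auto
  show ?thesis
    using variance_eq[of u] variance_positive[of u] by simp
qed

text \<open>Induction on the coordinates. With all but coordinate \<open>i\<close> fixed,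
  \<open>g i\<close> is a constant, so \<open>square_deviation_le\<close> splits off the term of
  \<open>i\<close> and leaves the variance of \<open>f\<close> with coordinate \<open>i\<close>
  integrated out. The induction hypothesis bounds that variance, and Jensen leads back to the
  differences of \<open>f\<close> and \<open>g j\<close>.\<close>

lemma efron_stein:
  fixes f :: "('i \<Rightarrow> 'a) \<Rightarrow> real" and g :: "'i \<Rightarrow> ('i \<Rightarrow> 'a) \<Rightarrow> real"
  assumes P: "\<And>i. prob_space (M i)" and "finite I"
    and "f \<in> borel_measurable (PiM I M)" "\<And>x. \<bar>f x\<bar> \<le> B"
    and "\<And>j. j \<in> I \<Longrightarrow> g j \<in> borel_measurable (PiM I M)" "\<And>j x. j \<in> I \<Longrightarrow> \<bar>g j x\<bar> \<le> B"
    and "\<And>j x t. j \<in> I \<Longrightarrow> g j (x(j := t)) = g j x"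
  shows "(\<integral>x. (f x - (\<integral>x. f x \<partial>PiM I M))\<^sup>2 \<partial>PiM I M) \<le> (\<Sum>j\<in>I. \<integral>x. (f x - g j x)\<^sup>2 \<partial>PiM I M)"
  using assms(2-)
proof (induction I arbitrary: f g rule: finite_induct)
  case empty
  show ?case by (simp add: PiM_empty lebesgue_integral_count_space_finite)
next
  case (insert i J)
  interpret sf: product_sigma_finite M
    using P by (simp add: product_sigma_finite_def prob_space_imp_sigma_finite)
  interpret Mi: prob_space "M i" by (rule P)
  interpret J: prob_space "PiM J M" by (rule prob_space_PiM[OF P])
  interpret K: prob_space "PiM (insert i J) M" by (rule prob_space_PiM[OF P])
  note [measurable] = insert.prems(1) insert.prems(3)
  have fB: "\<bar>f x\<bar> \<le> B" for x by (rule insert.prems(2))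
  have gB: "\<bar>g j x\<bar> \<le> B" if "j \<in> insert i J" for j x by (rule insert.prems(4)[OF that])
  have [measurable]: "(\<lambda>(y, t). y(i := t)) \<in> measurable (PiM J M \<Otimes>\<^sub>M M i) (PiM (insert i J) M)"
    by (rule measurable_add_dim)
  have upd: "(\<lambda>(y, t). u (y(i := t))) \<in> borel_measurable (PiM J M \<Otimes>\<^sub>M M i)"
    if [measurable]: "u \<in> borel_measurable (PiM (insert i J) M)" for u :: "_ \<Rightarrow> real"
  proof -
    have "(\<lambda>z. u ((\<lambda>(y, t). y(i := t)) z)) \<in> borel_measurable (PiM J M \<Otimes>\<^sub>M M i)"
      by measurable
    then show ?thesis by (simp add: case_prod_beta)
  qed
  have updt: "(\<lambda>t. u (y(i := t))) \<in> borel_measurable (M i)"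
    if "u \<in> borel_measurable (PiM (insert i J) M)" "y \<in> space (PiM J M)" for u :: "_ \<Rightarrow> real" and y
    using measurable_Pair2[OF upd[OF that(1)] that(2)] by simp
  define E where "E u = (\<lambda>y. \<integral>t. u (y(i := t)) \<partial>M i)" for u :: "_ \<Rightarrow> real"
  have Em [measurable]: "E u \<in> borel_measurable (PiM J M)"
    if "u \<in> borel_measurable (PiM (insert i J) M)" for u
    unfolding E_def using upd[OF that]
    by (rule sigma_finite_measure.borel_measurable_lebesgue_integral[OF sf.sigma_finite_measures])
  have fub: "integral\<^sup>L (PiM (insert i J) M) u = (\<integral>y. E u y \<partial>PiM J M)"
    if u: "u \<in> borel_measurable (PiM (insert i J) M)" "\<And>x. \<bar>u x\<bar> \<le> C" for u C
    unfolding E_def using insert.hyps u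
    by (intro sf.product_integral_insert K.integrable_const_bound[where B = C]) auto
  \<comment> \<open>The bound is stated for every \<open>y\<close>, also outside the space, where
    the slice may fail to be integrable; its integral is then 0 by default.\<close>
  have EB: "\<bar>E u y\<bar> \<le> C" if "\<And>x. \<bar>u x\<bar> \<le> C" for u C y
  proof -
    have "0 \<le> C" using that[of undefined] by linarith
    then show ?thesis
      unfolding E_def using Mi.prob_space that
      by (cases "integrable (M i) (\<lambda>t. u (y(i := t)))")
        (auto simp: not_integrable_integral_eq intro!: order_trans[OF integral_abs_bound]
          Mi.integral_le_const)
  qed
  have sqB: "\<bar>(a - b)\<^sup>2\<bar> \<le> (2 * C)\<^sup>2" if "\<bar>a\<bar> \<le> C" "\<bar>b\<bar> \<le> C" for a b C :: real
    using that abs_le_square_iff[of "a - b" "2 * C"] by auto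
  define m where "m = integral\<^sup>L (PiM (insert i J) M) f"
  have m: "m = (\<integral>y. E f y \<partial>PiM J M)"
    unfolding m_def by (rule fub) (auto intro: fB)
  have mB: "\<bar>m\<bar> \<le> B"
    unfolding m using EB[OF fB] J.prob_space
    by (auto intro!: order_trans[OF integral_abs_bound] J.integral_le_const
        J.integrable_const_bound[where B = B])
  have sqE: "(\<integral>x. (f x - u x)\<^sup>2 \<partial>PiM (insert i J) M) = (\<integral>y. E (\<lambda>x. (f x - u x)\<^sup>2) y \<partial>PiM J M)"
    if [measurable]: "u \<in> borel_measurable (PiM (insert i J) M)" and "\<And>x. \<bar>u x\<bar> \<le> B" for u
    using fB that by (intro fub[of _ "(2 * B)\<^sup>2"] sqB) auto
  have intE: "integrable (PiM J M) (E (\<lambda>x. (f x - u x)\<^sup>2))"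
    if [measurable]: "u \<in> borel_measurable (PiM (insert i J) M)" and "\<And>x. \<bar>u x\<bar> \<le> B" for u
    by (intro J.integrable_const_bound[where B = "(2 * B)\<^sup>2"] AE_I2)
      (unfold real_norm_def, rule EB, rule sqB[OF fB that(2)], measurable)
  have intJ: "integrable (PiM J M) (\<lambda>y. (E f y - v y)\<^sup>2)"
    if [measurable]: "v \<in> borel_measurable (PiM J M)" and "\<And>x. \<bar>v x\<bar> \<le> B" for v
    by (intro J.integrable_const_bound[where B = "(2 * B)\<^sup>2"] AE_I2)
      (unfold real_norm_def, rule sqB[OF EB[OF fB] that(2)], measurable)
  have "(\<integral>x. (f x - m)\<^sup>2 \<partial>PiM (insert i J) M) = (\<integral>y. E (\<lambda>x. (f x - m)\<^sup>2) y \<partial>PiM J M)"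
    using mB by (intro sqE) auto
  also have "\<dots> \<le> (\<integral>y. E (\<lambda>x. (f x - g i x)\<^sup>2) y + (E f y - m)\<^sup>2 \<partial>PiM J M)"
  proof (intro integral_mono Bochner_Integration.integrable_add intE intJ)
    fix y assume y: "y \<in> space (PiM J M)"
    \<comment> \<open>The slice of \<open>g i\<close> is constant, hence admissible as the
      \<open>c\<close> of \<open>square_deviation_le\<close>.\<close>
    have gi: "g i (y(i := t)) = g i y" for t
      by (rule insert.prems(5)) simp
    show "E (\<lambda>x. (f x - m)\<^sup>2) y \<le> E (\<lambda>x. (f x - g i x)\<^sup>2) y + (E f y - m)\<^sup>2"
      unfolding E_def gi by (rule Mi.square_deviation_le[OF updt[OF insert.prems(1) y] fB])
  qed (use mB gB in auto)
  also have "\<dots> = (\<integral>x. (f x - g i x)\<^sup>2 \<partial>PiM (insert i J) M) + (\<integral>y. (E f y - m)\<^sup>2 \<partial>PiM J M)"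
    using mB gB by (subst Bochner_Integration.integral_add) (auto intro!: intE intJ sqE[symmetric])
  also have "(\<integral>y. (E f y - m)\<^sup>2 \<partial>PiM J M) \<le> (\<Sum>j\<in>J. \<integral>y. (E f y - E (g j) y)\<^sup>2 \<partial>PiM J M)"
    unfolding m
  proof (rule insert.IH)
    show "E (g j) (y(j := s)) = E (g j) y" if "j \<in> J" for j y s
    proof -
      have "i \<noteq> j" using that insert.hyps by auto
      then have "y(j := s, i := t) = y(i := t, j := s)" for t
        by (rule fun_upd_twist[symmetric])
      then have "g j (y(j := s, i := t)) = g j (y(i := t))" for t
        using insert.prems(5)[of j "y(i := t)" s] that by (simp only: insertI2)
      then show ?thesis by (simp add: E_def)
    qed
  qed (use EB fB gB in auto)
  also have "\<dots> \<le> (\<Sum>j\<in>J. \<integral>x. (f x - g j x)\<^sup>2 \<partial>PiM (insert i J) M)"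
  proof (rule sum_mono)
    fix j assume j: "j \<in> J"
    then have [measurable]: "g j \<in> borel_measurable (PiM (insert i J) M)" by auto
    have "(\<integral>y. (E f y - E (g j) y)\<^sup>2 \<partial>PiM J M) \<le> (\<integral>y. E (\<lambda>x. (f x - g j x)\<^sup>2) y \<partial>PiM J M)"
    proof (intro integral_mono intE intJ)
      fix y assume y: "y \<in> space (PiM J M)"
      have [measurable]: "(\<lambda>t. f (y(i := t))) \<in> borel_measurable (M i)"
        "(\<lambda>t. g j (y(i := t))) \<in> borel_measurable (M i)"
        using y by (auto intro: updt)
      have "E f y - E (g j) y = (\<integral>t. f (y(i := t)) - g j (y(i := t)) \<partial>M i)"
        unfolding E_def using fB gB j
        by (intro Bochner_Integration.integral_diff[symmetric] Mi.integrable_const_bound[where B = B]) auto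
      \<comment> \<open>Jensen in coordinate \<open>i\<close> moves the square inside the
        integral.\<close>
      also have "\<dots>\<^sup>2 \<le> (\<integral>t. (f (y(i := t)) - g j (y(i := t)))\<^sup>2 \<partial>M i)"
      proof (rule Mi.square_integral_le[where B = "2 * B"])
        show "\<bar>f (y(i := t)) - g j (y(i := t))\<bar> \<le> 2 * B" for t
          using fB[of "y(i := t)"] gB[of j "y(i := t)"] j by auto
      qed simp
      finally show "(E f y - E (g j) y)\<^sup>2 \<le> E (\<lambda>x. (f x - g j x)\<^sup>2) y"
        by (simp only: E_def)
    qed (use j gB EB in auto)
    also have "\<dots> = (\<integral>x. (f x - g j x)\<^sup>2 \<partial>PiM (insert i J) M)"
      using j gB by (intro sqE[symmetric]) auto
    finally show "(\<integral>y. (E f y - E (g j) y)\<^sup>2 \<partial>PiM J M) \<le> (\<integral>x. (f x - g j x)\<^sup>2 \<partial>PiM (insert i J) M)" .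
  qed
  finally show ?case
    using insert.hyps by (simp add: m_def)
qed

text \<open>The joint law of independent variables is the product of their laws, so all expectations
  are integrals over a product space.\<close>

corollary (in prob_space) efron_stein_indep_vars:
  fixes f :: "('i \<Rightarrow> 'b) \<Rightarrow> real" and g :: "'i \<Rightarrow> ('i \<Rightarrow> 'b) \<Rightarrow> real"
  assumes indep: "indep_vars N X I" and "finite I" "I \<noteq> {}"
    and f [measurable]: "f \<in> borel_measurable (PiM I N)" and fB: "\<And>x. \<bar>f x\<bar> \<le> B"
    and g: "\<And>j. j \<in> I \<Longrightarrow> g j \<in> borel_measurable (PiM I N)" and gB: "\<And>j x. j \<in> I \<Longrightarrow> \<bar>g j x\<bar> \<le> B"
    and gj: "\<And>j x t. j \<in> I \<Longrightarrow> g j (x(j := t)) = g j x"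
  defines "Y \<equiv> \<lambda>\<omega>. \<lambda>i\<in>I. X i \<omega>"
  shows "expectation (\<lambda>\<omega>. (f (Y \<omega>) - expectation (\<lambda>\<omega>. f (Y \<omega>)))\<^sup>2)
    \<le> (\<Sum>j\<in>I. expectation (\<lambda>\<omega>. (f (Y \<omega>) - g j (Y \<omega>))\<^sup>2))"
proof -
  have X [measurable]: "X i \<in> measurable M (N i)" if "i \<in> I" for i
    using indep that by (auto simp: indep_vars_def)
  have Y [measurable]: "Y \<in> measurable M (PiM I N)"
    unfolding Y_def by (rule measurable_restrict) (rule X)
  \<comment> \<open>\<open>efron_stein\<close> asks for a probability space at every index; a point
    mass serves outside \<open>I\<close>.\<close>
  define L where "L i = (if i \<in> I then distr M (N i) (X i) else return (count_space UNIV) undefined)" for i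
  have prob: "prob_space (L i)" for i
    by (auto simp: L_def intro!: prob_space_distr X prob_space_return)
  have distr: "distr M (PiM I N) Y = PiM I L"
    using indep_vars_iff_distr_eq_PiM'[OF assms(3) X] indep unfolding Y_def
    by (auto simp: L_def intro!: PiM_cong)
  have "sets (PiM I L) = sets (PiM I N)"
    by (intro sets_PiM_cong) (auto simp: L_def)
  then have meas: "borel_measurable (PiM I L) = borel_measurable (PiM I N)"
    by (rule measurable_cong_sets) simp
  have tr: "expectation (\<lambda>\<omega>. u (Y \<omega>)) = integral\<^sup>L (PiM I L) u"
    if "u \<in> borel_measurable (PiM I N)" for u :: "_ \<Rightarrow> real"
    unfolding distr[symmetric] by (rule integral_distr[symmetric, OF Y that])
  have "(\<integral>x. (f x - (\<integral>x. f x \<partial>PiM I L))\<^sup>2 \<partial>PiM I L) \<le> (\<Sum>j\<in>I. \<integral>x. (f x - g j x)\<^sup>2 \<partial>PiM I L)"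
    by (rule efron_stein[where B = B]) (use assms prob meas in auto)
  moreover have "expectation (\<lambda>\<omega>. (f (Y \<omega>) - m)\<^sup>2) = (\<integral>x. (f x - m)\<^sup>2 \<partial>PiM I L)" for m
    by (rule tr) simp
  moreover have "expectation (\<lambda>\<omega>. (f (Y \<omega>) - g j (Y \<omega>))\<^sup>2) = (\<integral>x. (f x - g j x)\<^sup>2 \<partial>PiM I L)"
    if "j \<in> I" for j
    by (rule tr) (use g[OF that] in simp)
  ultimately show ?thesis
    using tr[OF f] by simp
qed

section \<open>Random tours\<close>

lemma borel_measurable_tour [measurable (raw)]:
  fixes X :: "'i \<Rightarrow> 'w \<Rightarrow> 'a::{metric_space, second_countable_topology}"
  assumes "finite I" and [measurable]: "\<And>i. i \<in> I \<Longrightarrow> X i \<in> borel_measurable M"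
  shows "(\<lambda>\<omega>. tour (\<lambda>i. X i \<omega>) I) \<in> borel_measurable M"
  unfolding tour_def
proof (rule borel_measurable_Min)
  show "finite (orderings I)" by (rule finite_orderings) fact
  fix l assume "l \<in> orderings I"
  then have l: "i < length l \<Longrightarrow> l ! i \<in> I" for i
    by (auto simp: orderings_def)
  have l_mod: "i < length l \<Longrightarrow> Suc i mod length l < length l" for i
    by (auto intro!: mod_less_divisor)
  have "(\<lambda>\<omega>. \<Sum>i<length l. dist (X (l ! i) \<omega>) (X (l ! ((i + 1) mod length l)) \<omega>)) \<in> borel_measurable M"
    by (intro borel_measurable_sum borel_measurable_dist assms(2) l) (simp_all add: l_mod)
  also have "?this \<longleftrightarrow> (\<lambda>\<omega>. cycle_length (map (\<lambda>i. X i \<omega>) l)) \<in> borel_measurable M"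
    unfolding cycle_length_def by (intro measurable_cong sum.cong) (simp_all add: l_mod)
  finally show "(\<lambda>\<omega>. cycle_length (map (\<lambda>i. X i \<omega>) l)) \<in> borel_measurable M" .
qed

text \<open>Reduces the case distinction in \<open>tsp_length\<close> to finitely many equalities
  between points, which are measurable conditions.\<close>

lemma card_image_le_2_iff:
  assumes "finite I" "I \<noteq> {}"
  shows "card (x ` I) \<le> 2 \<longleftrightarrow> (\<exists>i\<in>I. \<exists>j\<in>I. \<forall>k\<in>I. x k = x i \<or> x k = x j)"
proof
  assume le: "card (x ` I) \<le> 2"
  obtain i where i: "i \<in> I" using assms by auto
  show "\<exists>i\<in>I. \<exists>j\<in>I. \<forall>k\<in>I. x k = x i \<or> x k = x j"
  proof (rule ccontr)
    assume contr: "\<not> ?thesis"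
    then obtain j where j: "j \<in> I" "x j \<noteq> x i" using i by blast
    with contr i obtain k where k: "k \<in> I" "x k \<noteq> x i" "x k \<noteq> x j" by blast
    have "card {x i, x j, x k} \<le> card (x ` I)"
      using i j k assms by (intro card_mono) auto
    then show False using j k le by auto
  qed
next
  assume "\<exists>i\<in>I. \<exists>j\<in>I. \<forall>k\<in>I. x k = x i \<or> x k = x j"
  then obtain i j where "x ` I \<subseteq> {x i, x j}" by blast
  then have "card (x ` I) \<le> card {x i, x j}" by (intro card_mono) auto
  also have "\<dots> \<le> 2" by (simp add: card_insert_if)
  finally show "card (x ` I) \<le> 2" .
qed

lemma borel_measurable_tsp_length:
  fixes X :: "'i \<Rightarrow> 'w \<Rightarrow> 'a::{metric_space, second_countable_topology}"
  assumes "finite I" and X [measurable]: "\<And>i. i \<in> I \<Longrightarrow> X i \<in> borel_measurable M"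
  shows "(\<lambda>\<omega>. tsp_length ((\<lambda>i. X i \<omega>) ` I)) \<in> borel_measurable M"
proof (cases "I = {}")
  case False
  have [measurable]: "(\<lambda>\<omega>. tour (\<lambda>i. X i \<omega>) I) \<in> borel_measurable M"
    using assms by (rule borel_measurable_tour)
  have *: "card ((\<lambda>i. X i \<omega>) ` I) \<le> 2 \<longleftrightarrow>
      (\<exists>i\<in>I. \<exists>j\<in>I. \<forall>k\<in>I. dist (X k \<omega>) (X i \<omega>) = 0 \<or> dist (X k \<omega>) (X j \<omega>) = 0)" for \<omega>
    using card_image_le_2_iff[OF assms(1) False] by simp
  have [measurable]: "Measurable.pred M (\<lambda>\<omega>. card ((\<lambda>i. X i \<omega>) ` I) \<le> 2)"
    unfolding * using assms(1) by (intro pred_intros_finite) auto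
  show ?thesis
    unfolding tsp_length_eq_tour[OF assms(1)] by measurable
qed simp

text \<open>Nearest-point projection onto the square. It makes the tour a bounded function of
  arbitrary points, as the Efron--Stein inequality requires.\<close>

definition to_square :: "real \<times> real \<Rightarrow> real \<times> real" where
  "to_square p = (max (-1/2) (min (1/2) (fst p)), max (-1/2) (min (1/2) (snd p)))"

lemma to_square_in: "to_square p \<in> unit_square"
  by (auto simp: to_square_def unit_square_def)

lemma to_square_id: "p \<in> unit_square \<Longrightarrow> to_square p = p"
  by (auto simp: to_square_def unit_square_def)

lemma borel_measurable_to_square [measurable]: "to_square \<in> borel_measurable borel"
  unfolding to_square_def by (intro borel_measurable_continuous_onI continuous_intros)

text \<open>Efron--Stein is applied to \<open>tour\<close>, with the tour lacking point
  \<open>j\<close> as comparison function; for \<open>tsp_length\<close> the convention at two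
  points would break the insertion bound. The two lengths differ by at most 4, which costs only
  constants.\<close>

lemma (in prob_space) variance_tsp_le:
  fixes X :: "'i \<Rightarrow> 'a \<Rightarrow> real \<times> real"
  assumes indep: "indep_vars (\<lambda>_. borel) X I" and I: "finite I" "I \<noteq> {}"
    and sq: "\<And>i \<omega>. i \<in> I \<Longrightarrow> X i \<omega> \<in> unit_square"
  defines "T \<equiv> \<lambda>\<omega>. tsp_length ((\<lambda>i. X i \<omega>) ` I)"
  shows "expectation (\<lambda>\<omega>. (T \<omega> - expectation T)\<^sup>2) \<le> 48 * sqrt (card I) + 160"
proof -
  have X [measurable]: "X i \<in> borel_measurable M" if "i \<in> I" for i
    using indep that by (auto simp: indep_vars_def)
  define B where "B = 3 * sqrt (card I) + 8"
  define F where "F J x = tour (\<lambda>i. to_square (x i)) J" for J :: "'i set" and x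
  define W where "W \<omega> = tour (\<lambda>i. X i \<omega>) I" for \<omega>
  have [measurable]: "T \<in> borel_measurable M" "W \<in> borel_measurable M"
    unfolding T_def W_def using I X by (auto intro: borel_measurable_tsp_length borel_measurable_tour)
  have F_meas: "F J \<in> borel_measurable (PiM I (\<lambda>_. borel))" if "J \<subseteq> I" for J
  proof -
    have "(\<lambda>x. x i) \<in> borel_measurable (PiM I (\<lambda>_. borel :: (real \<times> real) measure))" if "i \<in> J" for i
      using that \<open>J \<subseteq> I\<close> by (intro measurable_component_singleton) auto
    then show ?thesis
      unfolding F_def using that I
      by (intro borel_measurable_tour measurable_compose[OF _ borel_measurable_to_square])
        (auto intro: finite_subset)
  qed
  have FB: "\<bar>F J x\<bar> \<le> B" if "J \<subseteq> I" for J x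
  proof -
    have fin: "finite J" using that I by (auto intro: finite_subset)
    have "F J x \<le> 3 * sqrt (card J) + 8"
      unfolding F_def using fin by (intro tour_le_sqrt) (auto intro: to_square_in)
    also have "\<dots> \<le> B"
      using that I by (auto simp: B_def intro: card_mono)
    finally show ?thesis
      using tour_nonneg[OF fin, of "\<lambda>i. to_square (x i)"] by (simp add: F_def)
  qed
  have FX: "F J (\<lambda>i\<in>I. X i \<omega>) = tour (\<lambda>i. X i \<omega>) J" if "J \<subseteq> I" for J \<omega>
    unfolding F_def using that by (intro tour_cong) (auto simp: to_square_id sq subset_iff)
  have WB: "\<bar>W \<omega>\<bar> \<le> B" for \<omega>
    using FB[of I "\<lambda>i\<in>I. X i \<omega>"] by (simp add: FX W_def)
  have B0: "0 \<le> B" by (simp add: B_def)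
  define D where "D j \<omega> = (W \<omega> - tour (\<lambda>i. X i \<omega>) (I - {j}))\<^sup>2" for j \<omega>
  have [simp]: "integrable M (D j)" for j
  proof (rule integrable_const_bound[where B = "(2 * B)\<^sup>2"], rule AE_I2)
    fix \<omega>
    have "\<bar>tour (\<lambda>i. X i \<omega>) (I - {j})\<bar> \<le> B"
      using FB[of "I - {j}" "\<lambda>i\<in>I. X i \<omega>"] by (simp add: FX Diff_subset)
    then have "\<bar>W \<omega> - tour (\<lambda>i. X i \<omega>) (I - {j})\<bar> \<le> \<bar>2 * B\<bar>"
      using WB[of \<omega>] by linarith
    then show "norm (D j \<omega>) \<le> (2 * B)\<^sup>2"
      unfolding D_def by (simp only: abs_le_square_iff real_norm_def abs_power2)
  next
    have "(\<lambda>\<omega>. tour (\<lambda>i. X i \<omega>) (I - {j})) \<in> borel_measurable M"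
      using I X by (intro borel_measurable_tour) auto
    then show "D j \<in> borel_measurable M"
      unfolding D_def by measurable
  qed
  have "expectation (\<lambda>\<omega>. (W \<omega> - expectation W)\<^sup>2) \<le> (\<Sum>j\<in>I. expectation (D j))"
  proof -
    have "expectation (\<lambda>\<omega>. (F I (\<lambda>i\<in>I. X i \<omega>) - expectation (\<lambda>\<omega>. F I (\<lambda>i\<in>I. X i \<omega>)))\<^sup>2)
      \<le> (\<Sum>j\<in>I. expectation (\<lambda>\<omega>. (F I (\<lambda>i\<in>I. X i \<omega>) - F (I - {j}) (\<lambda>i\<in>I. X i \<omega>))\<^sup>2))"
    proof (rule efron_stein_indep_vars[OF indep I, where B = B])
      show "F (I - {j}) (x(j := t)) = F (I - {j}) x" for j x t
        unfolding F_def by (rule tour_cong) auto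
    qed (auto intro!: F_meas FB)
    then show ?thesis
      by (simp add: FX Diff_subset D_def[abs_def] W_def[abs_def])
  qed
  also have "\<dots> = expectation (\<lambda>\<omega>. \<Sum>j\<in>I. D j \<omega>)"
    by simp
  also have "\<dots> \<le> 8 * B"
  proof (rule integral_le_const)
    have "(\<Sum>j\<in>I. D j \<omega>) \<le> 8 * B" for \<omega>
    proof -
      \<comment> \<open>Here 2 bounds the diameter of the unit square.\<close>
      have "(\<Sum>j\<in>I. D j \<omega>) \<le> 4 * 2 * W \<omega>"
        unfolding D_def W_def using I sq by (intro sum_tour_remove_le dist_unit_square_le) auto
      then show ?thesis using WB[of \<omega>] by linarith
    qed
    then show "AE \<omega> in M. (\<Sum>j\<in>I. D j \<omega>) \<le> 8 * B" by simp
  qed simp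
  finally have W: "expectation (\<lambda>\<omega>. (W \<omega> - expectation W)\<^sup>2) \<le> 8 * B" .
  have T: "0 \<le> T \<omega>" "T \<omega> \<le> W \<omega>" "W \<omega> \<le> T \<omega> + 4" for \<omega>
    unfolding T_def W_def
    using tsp_length_nonneg[OF I(1)] tsp_length_le_tour[OF I(1)]
      tour_le_tsp_length[OF I(1), of "\<lambda>i. X i \<omega>" 2] sq dist_unit_square_le by auto
  have TB: "\<bar>T \<omega>\<bar> \<le> B" for \<omega>
    using T[of \<omega>] WB[of \<omega>] by linarith
  have int: "integrable M (\<lambda>\<omega>. (U \<omega> - c)\<^sup>2)"
    if [measurable]: "U \<in> borel_measurable M" and "\<And>\<omega>. \<bar>U \<omega>\<bar> \<le> B" for U :: "'a \<Rightarrow> real" and c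
  proof (rule integrable_const_bound[where B = "(B + \<bar>c\<bar>)\<^sup>2"], rule AE_I2)
    fix \<omega>
    have "\<bar>U \<omega> - c\<bar> \<le> \<bar>B + \<bar>c\<bar>\<bar>"
      using that(2)[of \<omega>] by linarith
    then show "norm ((U \<omega> - c)\<^sup>2) \<le> (B + \<bar>c\<bar>)\<^sup>2"
      by (simp only: abs_le_square_iff real_norm_def abs_power2)
  qed simp
  \<comment> \<open>The variance of \<open>T\<close> only grows when its mean is replaced by the
    mean of \<open>W\<close>.\<close>
  have "expectation (\<lambda>\<omega>. (T \<omega> - expectation T)\<^sup>2) \<le> expectation (\<lambda>\<omega>. (T \<omega> - expectation W)\<^sup>2)"
    using square_deviation_le[of T B "expectation T" "expectation W"] TB by simp
  also have "\<dots> \<le> expectation (\<lambda>\<omega>. 2 * (W \<omega> - expectation W)\<^sup>2 + 32)"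
  proof (rule integral_mono)
    fix \<omega>
    define a b where "a = W \<omega> - expectation W" and "b = T \<omega> - W \<omega>"
    have "b\<^sup>2 \<le> 4\<^sup>2"
      using T[of \<omega>] by (subst abs_le_square_iff[symmetric]) (auto simp: b_def)
    moreover have "(a + b)\<^sup>2 \<le> 2 * a\<^sup>2 + 2 * b\<^sup>2"
      using zero_le_power2[of "a - b"] by (simp add: power2_eq_square algebra_simps)
    ultimately show "(T \<omega> - expectation W)\<^sup>2 \<le> 2 * (W \<omega> - expectation W)\<^sup>2 + 32"
      by (simp add: a_def b_def)
  qed (intro int TB WB Bochner_Integration.integrable_add integrable_mult_right; simp)+
  also have "\<dots> = 2 * expectation (\<lambda>\<omega>. (W \<omega> - expectation W)\<^sup>2) + 32"
    by (subst Bochner_Integration.integral_add) (auto intro!: int WB simp: prob_space)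
  \<comment> \<open>The constants are \<open>2 * 8 * 3 = 48\<close> and
    \<open>2 * 8 * 8 + 32 = 160\<close>.\<close>
  also have "\<dots> \<le> 48 * sqrt (card I) + 160"
    using W by (simp add: B_def)
  finally show ?thesis .
qed

text \<open>A short cycle occupies at most \<open>\<beta> * n\<close> of the at most
  \<open>4 * n\<close> cells, so \<open>prob_few_values\<close> gives at most
  \<open>(2 ^ 4 * \<beta> * K) ^ n\<close>. The value of \<open>\<beta>\<close> makes the base
  \<open>exp (- 1)\<close>.\<close>

lemma (in prob_space) tsp_lower_tail:
  fixes X :: "'i \<Rightarrow> 'a \<Rightarrow> real \<times> real"
  assumes indep: "indep_vars (\<lambda>_. borel) X I" and I: "finite I"
    and sq: "\<And>i. i \<in> I \<Longrightarrow> AE \<omega> in M. X i \<omega> \<in> unit_square"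
    and K: "0 < K" "\<And>k i c. 0 < k \<Longrightarrow> i \<in> I \<Longrightarrow> prob {\<omega> \<in> space M. cell k (X i \<omega>) = c} \<le> K / k\<^sup>2"
  defines "\<beta> \<equiv> 1 / (16 * exp 1 * K)"
  assumes n: "4 \<le> card I" "18 / \<beta> \<le> card I"
  shows "prob {\<omega> \<in> space M. tsp_length ((\<lambda>i. X i \<omega>) ` I) \<le> \<beta> / 36 * sqrt (card I)} \<le> exp (- real (card I))"
proof -
  define n where "n = card I"
  define k where "k = nat \<lceil>sqrt n\<rceil>"
  have pos: "0 < n" "I \<noteq> {}" using n by (auto simp: n_def)
  then have k: "0 < k" "sqrt n \<le> k" "k \<le> sqrt n + 1"
    unfolding k_def by (auto simp: of_nat_nat)
  \<comment> \<open>Ensures that \<open>k + 1\<close>, the number of cell indices per axis, is at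
    most \<open>sqrt n + 2\<close> and hence at most \<open>2 * sqrt n\<close>.\<close>
  have s2: "2 \<le> sqrt n"
    using n real_sqrt_le_mono[of 4 n] by (simp add: n_def)
  have sqrt_sq: "sqrt n * sqrt n = n" by simp
  have "\<beta> > 0" using K by (simp add: \<beta>_def)
  define G where "G = {0..int k} \<times> {0..int k}"
  have "real (k + 1) \<le> 2 * sqrt n" using k s2 by simp
  then have "(real (k + 1))\<^sup>2 \<le> (2 * sqrt n)\<^sup>2" by (intro power_mono) auto
  also have "\<dots> = 4 * n" by (simp add: power_mult_distrib)
  finally have "real (card G) \<le> 4 * n"
    by (simp add: G_def power2_eq_square nat_add_distrib algebra_simps)
  then have G: "card G \<le> 4 * n" by linarith
  have meas [measurable]: "X i \<in> borel_measurable M" if "i \<in> I" for i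
    using indep that by (auto simp: indep_vars_def)
  define Y where "Y i \<omega> = cell k (X i \<omega>)" for i \<omega>
  have indepY: "indep_vars (\<lambda>_. count_space UNIV) Y I"
    unfolding Y_def using k by (intro indep_vars_compose2[OF indep] measurable_cell) auto
  then have [measurable]: "Y i \<in> measurable M (count_space UNIV)" if "i \<in> I" for i
    using that by (auto simp: indep_vars_def)
  have "prob {\<omega> \<in> space M. tsp_length ((\<lambda>i. X i \<omega>) ` I) \<le> \<beta> / 36 * sqrt n}
    \<le> 2 ^ card G * (\<beta> * n * (K / (real k)\<^sup>2)) ^ card I"
  proof (rule prob_few_values[OF indepY I pos(2)])
    show "AE \<omega> in M. Y i \<omega> \<in> G" if "i \<in> I" for i
      using sq[OF that] by eventually_elim (simp add: Y_def G_def cell_in_range)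
    fix \<omega> assume "\<omega> \<in> {\<omega> \<in> space M. tsp_length ((\<lambda>i. X i \<omega>) ` I) \<le> \<beta> / 36 * sqrt n}"
    then have \<omega>: "\<omega> \<in> space M" and le: "tsp_length ((\<lambda>i. X i \<omega>) ` I) \<le> \<beta> / 36 * sqrt n"
      by auto
    have "k * tsp_length ((\<lambda>i. X i \<omega>) ` I) \<le> (2 * sqrt n) * (\<beta> / 36 * sqrt n)"
      using le k s2 tsp_length_nonneg[OF I] by (intro mult_mono) auto
    also have "\<dots> = \<beta> * n / 18"
      using sqrt_sq by simp
    finally have "9 * (1 + k * tsp_length ((\<lambda>i. X i \<omega>) ` I)) \<le> 9 * (1 + \<beta> * n / 18)"
      by (intro mult_left_mono add_left_mono) auto
    \<comment> \<open>The left side is \<open>9 + \<beta> * n / 2\<close>; the lower bound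
      \<open>18 / \<beta>\<close> on \<open>n\<close> absorbs the 9.\<close>
    also have "\<dots> \<le> \<beta> * n"
      using n(2) \<open>\<beta> > 0\<close> by (simp add: field_simps n_def)
    finally have "real (card (cell k ` (\<lambda>i. X i \<omega>) ` I)) \<le> \<beta> * n"
      using card_cells_le_tsp_length[of k I "\<lambda>i. X i \<omega>"] k I by simp
    with \<omega> show "\<omega> \<in> space M \<and> real (card ((\<lambda>i. Y i \<omega>) ` I)) \<le> \<beta> * n"
      by (simp add: Y_def image_image)
  qed (use K k \<open>\<beta> > 0\<close> in \<open>auto simp: G_def Y_def\<close>)
  also have "\<dots> \<le> 2 ^ (4 * n) * (\<beta> * K) ^ n"
  proof (intro mult_mono)
    \<comment> \<open>A cell has area \<open>1 / k\<^sup>2\<close>, at most \<open>1 / n\<close>,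
      which cancels the factor \<open>n\<close> in the number of occupied cells.\<close>
    have "real n = sqrt n * sqrt n" by simp
    also have "\<dots> \<le> real k * real k" using k by (intro mult_mono) auto
    finally have "n / (real k)\<^sup>2 \<le> 1" using k by (simp add: power2_eq_square field_simps)
    then have "\<beta> * K * (n / (real k)\<^sup>2) \<le> \<beta> * K * 1"
      using K \<open>\<beta> > 0\<close> by (intro mult_left_mono) auto
    then show "(\<beta> * n * (K / (real k)\<^sup>2)) ^ card I \<le> (\<beta> * K) ^ n"
      unfolding n_def[symmetric] using K \<open>\<beta> > 0\<close> by (intro power_mono) (auto simp: mult_ac)
  qed (use G K \<open>\<beta> > 0\<close> in auto)
  also have "\<dots> = (16 * (\<beta> * K)) ^ n"
    by (simp add: power_mult power_mult_distrib)
  also have "16 * (\<beta> * K) = exp (- 1)"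
    using K by (simp add: \<beta>_def exp_minus field_simps)
  also have "exp (- 1) ^ n = exp (- real n)"
    by (simp flip: exp_of_nat_mult)
  finally show ?thesis by (simp add: n_def)
qed

section \<open>Cell probabilities from the density, and convergence from the variance\<close>

lemma (in prob_space) distributed_cell_prob:
  assumes D: "distributed M lborel X (\<lambda>x. ennreal (f x) * indicator S x)"
    and f: "\<And>x. x \<in> S \<Longrightarrow> f x \<le> K" "0 \<le> K" and "0 < k"
  shows "prob {\<omega> \<in> space M. cell k (X \<omega>) = c} \<le> K / k\<^sup>2"
proof -
  have A: "cell k -` {c} \<in> sets lborel"
    using measurable_sets[OF measurable_cell[OF \<open>0 < k\<close>], of "{c}"] by simp
  have "ennreal (prob {\<omega> \<in> space M. cell k (X \<omega>) = c}) = emeasure M (X -` (cell k -` {c}) \<inter> space M)"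
    unfolding emeasure_eq_measure by (intro arg_cong[of _ _ ennreal] arg_cong[of _ _ prob]) auto
  also have "\<dots> = (\<integral>\<^sup>+x. ennreal (f x) * indicator S x * indicator (cell k -` {c}) x \<partial>lborel)"
    by (rule distributed_emeasure[OF D A])
  also have "\<dots> \<le> (\<integral>\<^sup>+x. ennreal K * indicator (cell k -` {c}) x \<partial>lborel)"
    using f by (intro nn_integral_mono mult_right_mono) (auto simp: indicator_def intro: ennreal_leI)
  also have "\<dots> = ennreal K * ennreal (1 / k\<^sup>2)"
    using A by (simp add: nn_integral_cmult_indicator emeasure_cell[OF \<open>0 < k\<close>])
  also have "\<dots> = ennreal (K / k\<^sup>2)"
    using f by (simp flip: ennreal_mult)
  finally show ?thesis
    using f by (simp add: ennreal_le_iff)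
qed

text \<open>By Chebyshev, normalising by \<open>sqrt n\<close> divides the variance bound by
  \<open>n\<close> and leaves a multiple of \<open>n powr (- 1/3)\<close>, which tends to 0.\<close>

lemma (in prob_space) converges_in_prob_variance:
  fixes T :: "nat \<Rightarrow> 'a \<Rightarrow> real"
  assumes T: "\<And>n. n \<ge> 1 \<Longrightarrow> T n \<in> borel_measurable M" "\<And>n. n \<ge> 1 \<Longrightarrow> integrable M (\<lambda>\<omega>. (T n \<omega>)\<^sup>2)"
    and var: "\<And>n. n \<ge> 1 \<Longrightarrow> expectation (\<lambda>\<omega>. (T n \<omega> - expectation (T n))\<^sup>2) \<le> C * real n powr (2/3)"
  shows "converges_in_prob M (\<lambda>n \<omega>. 1 / sqrt n * (T n \<omega> - expectation (T n))) 0"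
  unfolding converges_in_prob_def
proof (intro allI impI)
  fix \<epsilon> :: real assume "\<epsilon> > 0"
  let ?p = "\<lambda>n. prob {\<omega> \<in> space M. \<bar>1 / sqrt (real n) * (T n \<omega> - expectation (T n)) - 0\<bar> > \<epsilon>}"
  have "?p n \<le> C / \<epsilon>\<^sup>2 * real n powr (- 1/3)" if n: "n \<ge> 1" for n
  proof -
    have [measurable]: "T n \<in> borel_measurable M" by (rule T) fact
    have "?p n \<le> prob {\<omega> \<in> space M. \<epsilon> * sqrt n \<le> \<bar>T n \<omega> - expectation (T n)\<bar>}"
      using n by (intro finite_measure_mono) (auto simp: abs_mult field_simps)
    also have "\<dots> \<le> expectation (\<lambda>\<omega>. (T n \<omega> - expectation (T n))\<^sup>2) / (\<epsilon> * sqrt n)\<^sup>2"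
      using n \<open>\<epsilon> > 0\<close> by (intro Chebyshev_inequality T) auto
    also have "\<dots> \<le> C * real n powr (2/3) / (\<epsilon> * sqrt n)\<^sup>2"
      by (intro divide_right_mono var n) simp
    also have "\<dots> = C / \<epsilon>\<^sup>2 * (real n powr (2/3) / real n powr 1)"
      using n by (simp add: power_mult_distrib)
    also have "real n powr (2/3) / real n powr 1 = real n powr (- 1/3)"
      unfolding powr_diff[symmetric] by simp
    finally show ?thesis .
  qed
  then have "\<forall>\<^sub>F n in sequentially. ?p n \<le> C / \<epsilon>\<^sup>2 * real n powr (- 1/3)"
    by (rule eventually_sequentiallyI)
  moreover have "(\<lambda>n. C / \<epsilon>\<^sup>2 * real n powr (- 1/3)) \<longlonglongrightarrow> C / \<epsilon>\<^sup>2 * 0"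
    by (intro tendsto_mult tendsto_const tendsto_neg_powr filterlim_real_sequentially) auto
  ultimately show "?p \<longlonglongrightarrow> 0"
    by (intro tendsto_sandwich[of "\<lambda>_. 0" ?p sequentially "\<lambda>n. C / \<epsilon>\<^sup>2 * real n powr (- 1/3)"]) auto
qed

section \<open>Tours of random points with bounded density\<close>

theorem theorem2:
  fixes M :: "'w measure"
    and X :: "nat \<Rightarrow> nat \<Rightarrow> 'w \<Rightarrow> real \<times> real"
    and f :: "real \<times> real \<Rightarrow> real"
    and \<epsilon>\<^sub>1 \<epsilon>\<^sub>2 :: real
  assumes "prob_space M"
    and "prob_density_on unit_square f"
    and "0 < \<epsilon>\<^sub>1" and "\<epsilon>\<^sub>1 \<le> \<epsilon>\<^sub>2"
    and "ereal \<epsilon>\<^sub>1 \<le> (INF x\<in>unit_square. ereal (f x))"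
    and "(SUP x\<in>unit_square. ereal (f x)) \<le> ereal \<epsilon>\<^sub>2"
    and "\<And>n i. n \<ge> 1 \<Longrightarrow> i \<in> {1..n} \<Longrightarrow>
           distributed M lborel (X n i) (\<lambda>x. ennreal (f x) * indicator unit_square x)"
    and "\<And>n. n \<ge> 1 \<Longrightarrow> prob_space.indep_vars M (\<lambda>_. borel) (X n) {1..n}"
  shows "(\<forall>n\<ge>1. TSP X n \<in> borel_measurable M \<and> integrable M (\<lambda>\<omega>. (TSP X n \<omega>)\<^sup>2)) \<and>
    (\<exists>C>0. \<forall>n\<ge>1.
        prob_space.expectation M
          (\<lambda>\<omega>. (TSP X n \<omega> - prob_space.expectation M (TSP X n))\<^sup>2)
        \<le> C * real n powr (2/3)) \<and>
    converges_in_prob M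
      (\<lambda>n \<omega>. 1 / sqrt (real n) * (TSP X n \<omega> - prob_space.expectation M (TSP X n))) 0 \<and>
    (\<exists>\<theta>\<^sub>1>0. \<exists>\<theta>\<^sub>2>0. \<exists>\<theta>\<^sub>3>0. \<forall>\<^sub>F n in sequentially.
        \<theta>\<^sub>1 * sqrt (real n) \<le> prob_space.expectation M (TSP X n) \<and>
        prob_space.expectation M (TSP X n) \<le> 5 * sqrt (real n) \<and>
        prob_space.prob M {\<omega> \<in> space M. TSP X n \<omega> \<le> 5 * sqrt (real n)} = 1 \<and>
        prob_space.prob M {\<omega> \<in> space M. TSP X n \<omega> \<ge> \<theta>\<^sub>2 * sqrt (real n)}
          \<ge> 1 - exp (- (\<theta>\<^sub>3 * real n / ln (real n))))"
proof -
  interpret prob_space M by fact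
  have f_le: "f x \<le> \<epsilon>\<^sub>2" if "x \<in> unit_square" for x
    using SUP_upper[OF that, of "\<lambda>x. ereal (f x)"] assms(6) by (metis ereal_less_eq(3) order_trans)
  have "\<epsilon>\<^sub>2 > 0" using assms(3,4) by linarith
  have X [measurable]: "X n i \<in> borel_measurable M" if "n \<ge> 1" "i \<in> {1..n}" for n i
    using distributed_measurable[OF assms(7)[OF that]] by simp
  have sq: "AE \<omega> in M. X n i \<omega> \<in> unit_square" if "n \<ge> 1" "i \<in> {1..n}" for n i
  proof -
    have S: "unit_square \<in> sets borel"
      unfolding unit_square_def borel_prod[symmetric] by auto
    have "emeasure M (X n i -` (- unit_square) \<inter> space M) =
        (\<integral>\<^sup>+x. ennreal (f x) * indicator unit_square x * indicator (- unit_square) x \<partial>lborel)"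
      using S by (intro distributed_emeasure[OF assms(7)[OF that]]) auto
    also have "\<dots> = (\<integral>\<^sup>+x. 0 \<partial>(lborel :: (real \<times> real) measure))"
      by (intro nn_integral_cong) (auto simp: indicator_def)
    finally have "emeasure M (X n i -` (- unit_square) \<inter> space M) = 0" by simp
    moreover have "X n i -` (- unit_square) \<inter> space M \<in> events"
      using S by (intro measurable_sets[OF X[OF that]]) auto
    ultimately show ?thesis
      by (intro AE_I[of _ _ "X n i -` (- unit_square) \<inter> space M"]) auto
  qed
  have all_sq: "AE \<omega> in M. \<forall>i\<in>{1..n}. X n i \<omega> \<in> unit_square" if "n \<ge> 1" for n
    using sq that by (intro AE_ball_countable[THEN iffD2]) auto
  have T [measurable]: "TSP X n \<in> borel_measurable M" if "n \<ge> 1" for n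
    unfolding TSP_def[abs_def] using X that by (intro borel_measurable_tsp_length) auto
  have T0: "0 \<le> TSP X n \<omega>" for n \<omega>
    by (simp add: TSP_def tsp_length_nonneg)
  have T_le: "AE \<omega> in M. TSP X n \<omega> \<le> 3 * sqrt n + 8" if "n \<ge> 1" for n
    using all_sq[OF that]
  proof eventually_elim
    case (elim \<omega>)
    then have "tour (\<lambda>i. X n i \<omega>) {1..n} \<le> 3 * sqrt (card {1..n}) + 8"
      by (intro tour_le_sqrt) auto
    then show ?case
      using tsp_length_le_tour[of "{1..n}" "\<lambda>i. X n i \<omega>"] by (simp add: TSP_def)
  qed
  have int: "integrable M (TSP X n)" if "n \<ge> 1" for n
    using T_le[OF that] T0 T[OF that]
    by (intro integrable_const_bound[where B = "3 * sqrt n + 8"]) (auto elim!: eventually_mono)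
  have int2: "integrable M (\<lambda>\<omega>. (TSP X n \<omega>)\<^sup>2)" if "n \<ge> 1" for n
    using T_le[OF that] T0 T[OF that]
    by (intro integrable_const_bound[where B = "(3 * sqrt n + 8)\<^sup>2"])
      (auto elim!: eventually_mono intro!: power_mono)
  have var: "expectation (\<lambda>\<omega>. (TSP X n \<omega> - expectation (TSP X n))\<^sup>2) \<le> 208 * real n powr (2/3)"
    if n: "n \<ge> 1" for n
  proof -
    \<comment> \<open>Almost surely \<open>Z\<close> agrees with \<open>X\<close>, and it lies in
      the square everywhere, as \<open>variance_tsp_le\<close> demands.\<close>
    define Z where "Z i \<omega> = to_square (X n i \<omega>)" for i \<omega>
    define U where "U = (\<lambda>\<omega>. tsp_length ((\<lambda>i. Z i \<omega>) ` {1..n}))"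
    have indep: "indep_vars (\<lambda>_. borel) Z {1..n}"
      unfolding Z_def by (intro indep_vars_compose2[OF assms(8)[OF n]]) auto
    then have "Z i \<in> borel_measurable M" if "i \<in> {1..n}" for i
      using that by (auto simp: indep_vars_def)
    then have [measurable]: "U \<in> borel_measurable M"
      unfolding U_def by (intro borel_measurable_tsp_length) auto
    have eq: "AE \<omega> in M. TSP X n \<omega> = U \<omega>"
      using all_sq[OF n]
    proof eventually_elim
      case (elim \<omega>)
      then have "(\<lambda>i. X n i \<omega>) ` {1..n} = (\<lambda>i. Z i \<omega>) ` {1..n}"
        by (intro image_cong) (auto simp: Z_def to_square_id)
      then show ?case by (simp add: TSP_def U_def)
    qed
    have E: "expectation (TSP X n) = expectation U"
      using eq T[OF n] by (intro integral_cong_AE) auto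
    have "expectation (\<lambda>\<omega>. (TSP X n \<omega> - expectation (TSP X n))\<^sup>2) = expectation (\<lambda>\<omega>. (U \<omega> - expectation U)\<^sup>2)"
      unfolding E using eq T[OF n] by (intro integral_cong_AE) (auto elim!: eventually_mono)
    also have "\<dots> \<le> 48 * sqrt (card {1..n}) + 160"
      unfolding U_def using n by (intro variance_tsp_le[OF indep]) (auto simp: Z_def to_square_in)
    \<comment> \<open>Both \<open>sqrt n\<close> and 1 are at most \<open>n powr (2/3)\<close>, so
      the constants add up to 208.\<close>
    also have "\<dots> \<le> 48 * real n powr (2/3) + 160 * real n powr (2/3)"
    proof -
      have "sqrt n \<le> real n powr (2/3)"
        using n by (simp add: powr_half_sqrt[symmetric] powr_mono)
      moreover have "1 \<le> real n powr (2/3)"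
        using n by (simp add: ge_one_powr_ge_zero)
      ultimately show ?thesis by simp
    qed
    finally show ?thesis by simp
  qed
  define \<beta> where "\<beta> = 1 / (16 * exp 1 * \<epsilon>\<^sub>2)"
  define \<theta> where "\<theta> = \<beta> / 36"
  have "\<theta> > 0" using \<open>\<epsilon>\<^sub>2 > 0\<close> by (simp add: \<theta>_def \<beta>_def)
  have tail: "prob {\<omega> \<in> space M. TSP X n \<omega> \<ge> \<theta> * sqrt n} \<ge> 1 - exp (- real n)"
    if "n \<ge> 4" "18 / \<beta> \<le> n" for n
  proof -
    have n: "n \<ge> 1" using that by simp
    note [measurable] = T[OF n]
    have "prob {\<omega> \<in> space M. tsp_length ((\<lambda>i. X n i \<omega>) ` {1..n}) \<le> \<beta> / 36 * sqrt (card {1..n})}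
        \<le> exp (- real (card {1..n}))"
      unfolding \<beta>_def
    proof (rule tsp_lower_tail[OF assms(8)[OF n]])
      show "prob {\<omega> \<in> space M. cell k (X n i \<omega>) = c} \<le> \<epsilon>\<^sub>2 / k\<^sup>2" if "0 < k" "i \<in> {1..n}" for k i c
        using f_le \<open>\<epsilon>\<^sub>2 > 0\<close> that n by (intro distributed_cell_prob[OF assms(7)]) auto
    qed (use that n sq \<open>\<epsilon>\<^sub>2 > 0\<close> in \<open>auto simp: \<beta>_def\<close>)
    then have le: "prob {\<omega> \<in> space M. TSP X n \<omega> \<le> \<theta> * sqrt n} \<le> exp (- real n)"
      by (simp add: TSP_def \<theta>_def)
    have "1 - prob {\<omega> \<in> space M. TSP X n \<omega> \<le> \<theta> * sqrt n} = prob (space M - {\<omega> \<in> space M. TSP X n \<omega> \<le> \<theta> * sqrt n})"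
      by (intro prob_compl[symmetric]) measurable
    also have "\<dots> \<le> prob {\<omega> \<in> space M. TSP X n \<omega> \<ge> \<theta> * sqrt n}"
      by (intro finite_measure_mono) auto
    finally show ?thesis using le by linarith
  qed
  \<comment> \<open>The witnesses are \<open>\<theta> / 2\<close>, \<open>\<theta>\<close> and 1.
    From \<open>n = 16\<close> on, \<open>8 \<le> 2 * sqrt n\<close>, so the strip bound
    \<open>3 * sqrt n + 8\<close> is at most \<open>5 * sqrt n\<close>.\<close>
  have large: "\<forall>\<^sub>F n in sequentially.
        \<theta> / 2 * sqrt (real n) \<le> expectation (TSP X n) \<and>
        expectation (TSP X n) \<le> 5 * sqrt (real n) \<and>
        prob {\<omega> \<in> space M. TSP X n \<omega> \<le> 5 * sqrt (real n)} = 1 \<and>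
        prob {\<omega> \<in> space M. TSP X n \<omega> \<ge> \<theta> * sqrt (real n)} \<ge> 1 - exp (- (1 * real n / ln (real n)))"
    using eventually_ge_at_top[of 16] eventually_ge_at_top[of "nat \<lceil>18 / \<beta>\<rceil>"]
  proof eventually_elim
    case (elim n)
    then have n: "n \<ge> 1" "n \<ge> 4" "18 / \<beta> \<le> n" by linarith+
    note [measurable] = T[OF n(1)]
    have "4 \<le> sqrt n"
      using elim real_sqrt_le_mono[of 16 n] by simp
    then have T5: "AE \<omega> in M. TSP X n \<omega> \<le> 5 * sqrt n"
      using T_le[OF n(1)] by (auto elim!: eventually_mono)
    have P: "prob {\<omega> \<in> space M. TSP X n \<omega> \<ge> \<theta> * sqrt n} \<ge> 1 - exp (- real n)"
      by (rule tail[OF n(2,3)])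
    have "exp (- real n) \<le> exp (- 1)"
      using n by simp
    also have "\<dots> \<le> 1 / 2"
      using exp_ge_add_one_self[of 1] by (simp add: exp_minus field_simps)
    finally have half: "1 / 2 \<le> prob {\<omega> \<in> space M. TSP X n \<omega> \<ge> \<theta> * sqrt n}"
      using P by linarith
    have pos: "0 < \<theta> * sqrt n" using n \<open>\<theta> > 0\<close> by simp
    \<comment> \<open>The Markov inequality turns a probability of at least one half into the lower
      bound on the mean.\<close>
    have "prob {\<omega> \<in> space M. TSP X n \<omega> \<ge> \<theta> * sqrt n} \<le> expectation (TSP X n) / (\<theta> * sqrt n)"
      by (rule integral_Markov_inequality_measure[where A = "{}"]) (use int n T0 pos in auto)
    with half have "1 / 2 \<le> expectation (TSP X n) / (\<theta> * sqrt n)" by linarith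
    then have low: "\<theta> / 2 * sqrt n \<le> expectation (TSP X n)"
      using pos by (simp add: field_simps)
    \<comment> \<open>Since \<open>ln n\<close> is at least 1, the tail \<open>exp (- n)\<close> is
      stronger than the required one.\<close>
    have "ln (exp 1) \<le> ln (real n)"
      using n exp_le by (subst ln_le_cancel_iff) auto
    then have "1 \<le> ln (real n)" by simp
    then have "real n / ln n \<le> real n / 1"
      by (intro divide_left_mono) auto
    then have "exp (- real n) \<le> exp (- (1 * real n / ln (real n)))" by simp
    with P have "1 - exp (- (1 * real n / ln (real n))) \<le> prob {\<omega> \<in> space M. TSP X n \<omega> \<ge> \<theta> * sqrt n}"
      by linarith
    with low T5 show ?case
      using integral_le_const[OF int[OF n(1)] T5] by (auto intro!: prob_eq_1[THEN iffD2])
  qed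
  show ?thesis
  proof (intro conjI)
    show "\<forall>n\<ge>1. TSP X n \<in> borel_measurable M \<and> integrable M (\<lambda>\<omega>. (TSP X n \<omega>)\<^sup>2)"
      using T int2 by auto
    show "\<exists>C>0. \<forall>n\<ge>1. expectation (\<lambda>\<omega>. (TSP X n \<omega> - expectation (TSP X n))\<^sup>2) \<le> C * real n powr (2/3)"
      using var by (intro exI[of _ 208]) auto
    show "converges_in_prob M (\<lambda>n \<omega>. 1 / sqrt (real n) * (TSP X n \<omega> - expectation (TSP X n))) 0"
      by (rule converges_in_prob_variance[OF T int2 var])
    show "\<exists>\<theta>\<^sub>1>0. \<exists>\<theta>\<^sub>2>0. \<exists>\<theta>\<^sub>3>0. \<forall>\<^sub>F n in sequentially.
        \<theta>\<^sub>1 * sqrt (real n) \<le> expectation (TSP X n) \<and>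
        expectation (TSP X n) \<le> 5 * sqrt (real n) \<and>
        prob {\<omega> \<in> space M. TSP X n \<omega> \<le> 5 * sqrt (real n)} = 1 \<and>
        prob {\<omega> \<in> space M. TSP X n \<omega> \<ge> \<theta>\<^sub>2 * sqrt (real n)} \<ge> 1 - exp (- (\<theta>\<^sub>3 * real n / ln (real n)))"
      using large \<open>\<theta> > 0\<close> by (intro exI[of _ "\<theta> / 2"] exI[of _ \<theta>] exI[of _ 1] conjI) auto
  qed
qed

end
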